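(* Let $G$ be a Meyniel graph. Then the toric ideal $I_G$ of the stable set polytope of $G$ is generated by quadratic binomials.
   Context: All graphs are finite and simple. A graph is called Meyniel if any odd cycle of length $\ge 5$ in it has at least two chords. Let $G$ be a graph on the vertex set $[n]=\{1,\dots,n\}$. A subset $S\subset[n]$ is a stable set of $G$ if no two distinct elements of $S$ are adjacent in $G$; the empty set and singletons are stable. Let $S(G)=\{S_1,\dots,S_m\}$ be the set of all stable sets of $G$. For $S\subset[n]$ put $\rho(S)=\sum_{j\in S}\mathbf{e}_j\in\mathbb{R}^n$, where $\mathbf{e}_j$ is the $j$-th unit coordinate vector. The stable set polytope of $G$ is the convex hull of $\{\rho(S_1),\dots,\rho(S_m)\}$. Let $K$ be a field, and let $K[x_1,\dots,x_m]$ and $K[t_1,\dots,t_n,s]$ be polynomial rings. The toric ideal $I_G$ of the stable set polytope of $G$ is the kernel of the $K$-algebra homomorphism $\pi_G:K[x_1,\dots,x_m]\to K[t_1,\dots,t_n,s]$ given by $\pi_G(x_i)=\mathbf{t}^{\rho(S_i)}s$, where $\mathbf{t}^{\mathbf{a}}=t_1^{a_1}\cdots t_n^{a_n}$. Convention: if $I_G=\{0\}$ (which happens exactly when $G$ is complete), then $I_G$ is also said to be generated by quadratic binomials. *)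

theory Defs
  imports "HOL-Library.Poly_Mapping" "HOL-Algebra.RingHom"
begin

section \<open>Graphs\<close>

text \<open>Edges are two-element sets of vertices, so loops and multiple edges are excluded.\<close>

definition simple_graph :: "'a set \<Rightarrow> 'a set set \<Rightarrow> bool" where
  "simple_graph V E \<longleftrightarrow> finite V \<and> E \<subseteq> {e. e \<subseteq> V \<and> card e = 2}"

definition cycle_edges :: "'a list \<Rightarrow> 'a set set" where
  "cycle_edges vs = {{vs ! i, vs ! (Suc i mod length vs)} | i. i < length vs}"

text \<open>A cycle is given by the list of its vertices in cyclic order; its length is the length
  of the list.\<close>

definition is_cycle :: "'a set set \<Rightarrow> 'a list \<Rightarrow> bool" where
  "is_cycle E vs \<longleftrightarrow> length vs \<ge> 3 \<and> distinct vs \<and> cycle_edges vs \<subseteq> E"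

definition chords :: "'a set set \<Rightarrow> 'a list \<Rightarrow> 'a set set" where
  "chords E vs = {e \<in> E. e \<subseteq> set vs} - cycle_edges vs"

definition meyniel :: "'a set set \<Rightarrow> bool" where
  "meyniel E \<longleftrightarrow>
     (\<forall>vs. is_cycle E vs \<and> odd (length vs) \<and> length vs \<ge> 5 \<longrightarrow> card (chords E vs) \<ge> 2)"

definition stable_sets :: "'a set \<Rightarrow> 'a set set \<Rightarrow> 'a set set" where
  "stable_sets V E = {S. S \<subseteq> V \<and> (\<forall>i\<in>S. \<forall>j\<in>S. i \<noteq> j \<longrightarrow> {i, j} \<notin> E)}"

section \<open>Polynomial rings\<close>

text \<open>A polynomial maps exponent vectors (finitely supported, on variables of type
  \<open>'v\<close>) to coefficients. The type carries the polynomial ring in all variables of type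
  \<open>'v\<close>; the ring in the variables from a set \<open>X\<close> is a subring of it.\<close>

type_synonym ('v, 'k) mpoly = "('v \<Rightarrow>\<^sub>0 nat) \<Rightarrow>\<^sub>0 'k"

definition mpoly_ring :: "'v set \<Rightarrow> ('v, 'k::comm_ring_1) mpoly ring" where
  "mpoly_ring X = \<lparr>carrier = {f. \<forall>m \<in> Poly_Mapping.keys f. Poly_Mapping.keys m \<subseteq> X},
     mult = (*), one = 1, zero = 0, add = (+)\<rparr>"

definition Const :: "'k::comm_ring_1 \<Rightarrow> ('v, 'k) mpoly" where
  "Const c = Poly_Mapping.single 0 c"

definition Var :: "'v \<Rightarrow> ('v, 'k::comm_ring_1) mpoly" where
  "Var v = Poly_Mapping.single (Poly_Mapping.single v 1) 1"

text \<open>The algebra homomorphism over the coefficient ring that sends each variable \<open>v\<close> to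
  \<open>g v\<close>.\<close>

definition subst_hom ::
  "('v \<Rightarrow> ('w, 'k::comm_ring_1) mpoly) \<Rightarrow> ('v, 'k) mpoly \<Rightarrow> ('w, 'k) mpoly" where
  "subst_hom g f = (\<Sum>m \<in> Poly_Mapping.keys f.
     Const (Poly_Mapping.lookup f m) *
       (\<Prod>v \<in> Poly_Mapping.keys m. g v ^ Poly_Mapping.lookup m v))"

definition mon_degree :: "('v \<Rightarrow>\<^sub>0 nat) \<Rightarrow> nat" where
  "mon_degree m = (\<Sum>v \<in> Poly_Mapping.keys m. Poly_Mapping.lookup m v)"

definition quadratic_binomial :: "('v, 'k::comm_ring_1) mpoly \<Rightarrow> bool" where
  "quadratic_binomial f \<longleftrightarrow>
     (\<exists>u v. u \<noteq> v \<and> mon_degree u = 2 \<and> mon_degree v = 2 \<and>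
        f = Poly_Mapping.single u 1 - Poly_Mapping.single v 1)"

text \<open>The generating set may be empty, so the zero ideal counts as generated by quadratic
  binomials.\<close>

definition generated_by_quadratic_binomials ::
  "('v, 'k::comm_ring_1) mpoly ring \<Rightarrow> ('v, 'k) mpoly set \<Rightarrow> bool" where
  "generated_by_quadratic_binomials R I \<longleftrightarrow>
     (\<exists>B \<subseteq> carrier R. (\<forall>f\<in>B. quadratic_binomial f) \<and> I = Idl\<^bsub>R\<^esub> B)"

section \<open>The toric ideal of the stable set polytope\<close>

datatype tvar = TVar nat | SVar

definition rho :: "nat set \<Rightarrow> (nat \<Rightarrow>\<^sub>0 nat)" where
  "rho A = (\<Sum>j\<in>A. Poly_Mapping.single j 1)"

definition t_power :: "nat \<Rightarrow> (nat \<Rightarrow>\<^sub>0 nat) \<Rightarrow> (tvar, 'k::comm_ring_1) mpoly" where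
  "t_power n a = (\<Prod>j = 1..n. Var (TVar j) ^ Poly_Mapping.lookup a j)"

text \<open>The variables \<open>x\<^sub>1, \<dots>, x\<^sub>m\<close> are indexed by the stable sets
  \<open>S\<^sub>1, \<dots>, S\<^sub>m\<close> themselves.\<close>

definition source_ring :: "nat \<Rightarrow> nat set set \<Rightarrow> (nat set, 'k::comm_ring_1) mpoly ring" where
  "source_ring n E = mpoly_ring (stable_sets {1..n} E)"

definition target_ring :: "nat \<Rightarrow> (tvar, 'k::comm_ring_1) mpoly ring" where
  "target_ring n = mpoly_ring (insert SVar (TVar ` {1..n}))"

definition toric_map :: "nat \<Rightarrow> (nat set, 'k::comm_ring_1) mpoly \<Rightarrow> (tvar, 'k) mpoly" where
  "toric_map n = subst_hom (\<lambda>A. t_power n (rho A) * Var SVar)"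

definition toric_ideal :: "nat \<Rightarrow> nat set set \<Rightarrow> (nat set, 'k::comm_ring_1) mpoly set" where
  "toric_ideal n E = a_kernel (source_ring n E) (target_ring n) (toric_map n)"

end

theory Submission
  imports Defs "HOL-Library.Multiset"
begin

text \<open>A monomial in the variables \<open>x\<^sub>S\<close> is a multiset of stable sets, and two monomials have the
  same image under the toric map iff the multisets have the same size and cover every vertex
  equally often. The toric ideal is therefore spanned by the differences of monomials in a common
  fibre. A difference of two monomials that arise from each other by exchanging two stable sets
  \<open>A, B\<close> for \<open>A', B'\<close> with the same total is a multiple of a quadratic binomial, so it suffices to
  connect any two members of a fibre by such exchanges (lemma \<open>fibre_connected\<close>). The exchanges are
  Kempe changes: swap a connected component of the graph induced on the symmetric difference of
  \<open>A\<close> and \<open>B\<close>.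

  Connectedness follows by induction on the size, once there is a stable set, depending only on the
  set \<open>H\<close> of covered vertices, that every member of the fibre can be made to contain (lemma
  \<open>common_stable_set\<close>). This set is grown vertex by vertex. Suppose that some member can already be
  made to contain a stable set including \<open>T\<close>, and contract \<open>T\<close> to a single vertex \<open>t\<close>. If \<open>z\<close> is
  not adjacent to \<open>t\<close> and all induced paths from \<open>t\<close> to \<open>z\<close> have even length, then a class
  \<open>A \<supseteq> T\<close> and a class \<open>B\<close> containing \<open>z\<close> can be exchanged so that \<open>z\<close> joins \<open>T\<close>: the component of
  \<open>z\<close> in the bipartite graph on the symmetric difference misses \<open>t\<close>, because a shortest path from
  \<open>t\<close> to \<open>z\<close> in it would be induced and odd (lemma \<open>kempe_merge\<close>).

  Such a vertex \<open>z\<close> always exists. Following Hertz, choose \<open>z\<close> among the non-neighbours of \<open>t\<close> with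
  as many common neighbours with \<open>t\<close> as possible. Contraction does not preserve the Meyniel
  property, but it preserves a weaker one: there is no odd hole, and if a vertex outside a hole sees
  exactly two vertices of it, and these are consecutive, then one of the two is \<open>t\<close>. For graphs with
  this property the choice of \<open>z\<close> gives an even pair (lemma \<open>best_partner_even_pair\<close>), and the
  property survives the contraction of \<open>z\<close> into \<open>t\<close> (lemma \<open>quasi_meyniel_contract\<close>). In both
  arguments maximality supplies, for an induced path from \<open>t\<close> to \<open>z\<close>, a common neighbour \<open>c\<close> of its
  ends that is not adjacent to the third vertex of the path. The neighbours of \<open>c\<close> cut the path into segments;
  a segment of length at least two closes up with \<open>c\<close> to a hole, so it is even, and a segment of
  length one never lies next to a longer one. As \<open>c\<close> is not adjacent to the whole path, all segments, and hence the
  path, are even.\<close>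

section \<open>Holes and induced paths\<close>

text \<open>Graphs are given by an adjacency relation; there is no vertex set, and vertices without
  neighbours play no role.\<close>

text \<open>A hole of length \<open>L\<close>: the vertices \<open>h 0, \<dots>, h (L - 1)\<close> induce a cycle of length \<open>L \<ge> 4\<close>. Values of
  \<open>h\<close> outside \<open>{..<L}\<close> are irrelevant.\<close>

definition hole :: "('a \<Rightarrow> 'a \<Rightarrow> bool) \<Rightarrow> (nat \<Rightarrow> 'a) \<Rightarrow> nat \<Rightarrow> bool" where
  "hole R h L \<longleftrightarrow> 4 \<le> L \<and> inj_on h {..<L} \<and>
     (\<forall>i<L. \<forall>j<L. R (h i) (h j) \<longleftrightarrow> j = Suc i mod L \<or> i = Suc j mod L)"

text \<open>An induced path of length \<open>k\<close>, with vertices \<open>p 0, \<dots>, p k\<close>.\<close>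

definition induced_path :: "('a \<Rightarrow> 'a \<Rightarrow> bool) \<Rightarrow> (nat \<Rightarrow> 'a) \<Rightarrow> nat \<Rightarrow> bool" where
  "induced_path R p k \<longleftrightarrow> inj_on p {..k} \<and>
     (\<forall>i\<le>k. \<forall>j\<le>k. R (p i) (p j) \<longleftrightarrow> j = Suc i \<or> i = Suc j)"

lemma induced_pathI:
  assumes "\<And>x y. x \<le> k \<Longrightarrow> y \<le> k \<Longrightarrow> p x = p y \<Longrightarrow> x = y"
    and "\<And>x y. x \<le> k \<Longrightarrow> y \<le> k \<Longrightarrow> R (p x) (p y) \<longleftrightarrow> y = Suc x \<or> x = Suc y"
  shows "induced_path R p k"
  unfolding induced_path_def inj_on_def using assms by blast

lemma holeI:
  assumes "4 \<le> L" "\<And>i j. i < L \<Longrightarrow> j < L \<Longrightarrow> h i = h j \<Longrightarrow> i = j"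
    and "\<And>i j. i < L \<Longrightarrow> j < L \<Longrightarrow> R (h i) (h j) \<longleftrightarrow> j = Suc i mod L \<or> i = Suc j mod L"
  shows "hole R h L"
  unfolding hole_def inj_on_def using assms by blast

text \<open>The property that survives contraction. As holes are even, a vertex \<open>q\<close> outside a hole whose only neighbours on it are
  two consecutive vertices yields an odd cycle with exactly one chord, namely the edge joining these
  two; this is tolerated only if the contracted vertex \<open>t\<close> is an end of that chord.\<close>

definition quasi_meyniel :: "('a \<Rightarrow> 'a \<Rightarrow> bool) \<Rightarrow> 'a \<Rightarrow> bool" where
  "quasi_meyniel R t \<longleftrightarrow>
     (\<forall>h L. hole R h L \<longrightarrow> even L) \<and>
     (\<forall>h L q i. hole R h L \<and> i < L \<and> q \<notin> h ` {..<L} \<and>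
        (\<forall>j<L. R q (h j) \<longleftrightarrow> j = i \<or> j = Suc i mod L) \<longrightarrow> t = h i \<or> t = h (Suc i mod L))"

lemma quasi_meyniel_even_hole:
  "quasi_meyniel R t \<Longrightarrow> hole R h L \<Longrightarrow> even L"
  unfolding quasi_meyniel_def by blast

lemma quasi_meyniel_house:
  assumes "quasi_meyniel R t" "hole R h L" "i < L" "q \<notin> h ` {..<L}"
    and "\<And>j. j < L \<Longrightarrow> R q (h j) \<longleftrightarrow> j = i \<or> j = Suc i mod L"
  shows "t = h i \<or> t = h (Suc i mod L)"
  using assms unfolding quasi_meyniel_def by blast

lemma Suc_mod_eq: "i < L \<Longrightarrow> Suc i mod L = (if Suc i = L then 0 else Suc i)"
  by auto

section \<open>The neighbours of a vertex on an induced path\<close>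

text \<open>The indices \<open>a < b\<close> are consecutive among the indices of the neighbours of \<open>c\<close> on the path \<open>p\<close>.\<close>

definition seg :: "('a \<Rightarrow> 'a \<Rightarrow> bool) \<Rightarrow> (nat \<Rightarrow> 'a) \<Rightarrow> 'a \<Rightarrow> nat \<Rightarrow> nat \<Rightarrow> bool" where
  "seg R p c a b \<longleftrightarrow> a < b \<and> R c (p a) \<and> R c (p b) \<and> (\<forall>j. a < j \<and> j < b \<longrightarrow> \<not> R c (p j))"

text \<open>The segment of \<open>p\<close> from \<open>a\<close> to \<open>b\<close> followed by \<open>c\<close>, as a cyclic sequence of length \<open>b - a + 2\<close>.\<close>

definition close_up :: "(nat \<Rightarrow> 'a) \<Rightarrow> 'a \<Rightarrow> nat \<Rightarrow> nat \<Rightarrow> nat \<Rightarrow> 'a" where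
  "close_up p c a b i = (if i = Suc (b - a) then c else p (a + i))"

lemma hole_close_up:
  assumes R: "symp R" "irreflp R" and p: "induced_path R p k" and c: "c \<notin> p ` {..k}"
    and s: "seg R p c a b" and ab: "a + 2 \<le> b" "b \<le> k"
  shows "hole R (close_up p c a b) (b - a + 2)"
proof -
  let ?h = "close_up p c a b"
  have inj: "inj_on p {..k}" and adj: "\<And>i j. i \<le> k \<Longrightarrow> j \<le> k \<Longrightarrow> R (p i) (p j) \<longleftrightarrow> j = Suc i \<or> i = Suc j"
    using p unfolding induced_path_def by auto
  have c1: "\<And>i. i \<le> k \<Longrightarrow> p i \<noteq> c" using c by auto
  have cn: "R c (p j) \<longleftrightarrow> j = a \<or> j = b" if "a \<le> j" "j \<le> b" for j
    using s that unfolding seg_def by (metis le_neq_implies_less)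
  have sy: "\<And>u v. R u v = R v u" using R(1) by (meson sympD)
  have "inj_on ?h {..<b - a + 2}"
  proof (rule inj_onI)
    fix x y assume xy: "x \<in> {..<b - a + 2}" "y \<in> {..<b - a + 2}" "?h x = ?h y"
    have "x \<noteq> Suc (b-a) \<Longrightarrow> a + x \<le> k" "y \<noteq> Suc (b-a) \<Longrightarrow> a + y \<le> k" using xy ab by auto
    then show "x = y" using xy c1 inj_onD[OF inj, of "a+x" "a+y"]
      unfolding close_up_def by (auto split: if_splits)
  qed
  moreover have "R (?h i) (?h j) \<longleftrightarrow> j = Suc i mod (b - a + 2) \<or> i = Suc j mod (b - a + 2)"
    if ij: "i < b - a + 2" "j < b - a + 2" for i j
  proof -
    have 1: "i \<noteq> Suc (b-a) \<Longrightarrow> a + i \<le> b" "j \<noteq> Suc (b-a) \<Longrightarrow> a + j \<le> b" using ij ab by auto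
    have irr: "\<not> R c c" using R(2) by (meson irreflpD)
    show ?thesis
      unfolding Suc_mod_eq[OF ij(1)] Suc_mod_eq[OF ij(2)] close_up_def
      using 1 ab ij irr cn[of "a+i"] cn[of "a+j"] sy[of c "p (a+i)"] adj[of "a+i" "a+j"]
      by (auto split: if_splits)
  qed
  ultimately show ?thesis using ab unfolding hole_def by auto
qed

lemma close_up_notin:
  assumes "a \<le> b" "\<And>j. a \<le> j \<Longrightarrow> j \<le> b \<Longrightarrow> q \<noteq> p j" "q \<noteq> c"
  shows "q \<notin> close_up p c a b ` {..<b - a + 2}"
proof
  assume "q \<in> close_up p c a b ` {..<b - a + 2}"
  then obtain i where i: "i < b - a + 2" "q = close_up p c a b i" by auto
  then show False using assms(1) assms(2)[of "a + i"] assms(3)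
    by (cases "i = Suc (b - a)") (auto simp: close_up_def)
qed

lemma seg_parity:
  assumes R: "symp R" "irreflp R" and Q: "quasi_meyniel R t"
    and p: "induced_path R p k" and c: "c \<notin> p ` {..k}"
    and s: "seg R p c a b" "b \<le> k"
  shows "b = Suc a \<or> even (b - a)"
proof (cases "a + 2 \<le> b")
  case True
  then have "even (b - a + 2)"
    using quasi_meyniel_even_hole[OF Q] hole_close_up[OF R p c s(1) _ s(2)] by blast
  then show ?thesis by simp
next
  case False
  then show ?thesis using s unfolding seg_def by auto
qed

text \<open>The three ways in which a vertex \<open>q\<close> can see exactly two consecutive vertices of the hole formed
  by a segment and \<open>c\<close>: the last vertex of the segment and \<open>c\<close>, the first one and \<open>c\<close>, or two
  neighbours on the segment. Each is excluded unless one of the two vertices seen is \<open>t\<close>; the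
  assumptions allow this only for \<open>p 0\<close>.\<close>

lemma seg_house:
  assumes R: "symp R" "irreflp R" and Q: "quasi_meyniel R t"
    and p: "induced_path R p k" and c: "c \<notin> p ` {..k}"
    and s: "seg R p c a b" "b \<le> k" "a + 2 \<le> b"
    and q: "q \<noteq> c" "\<And>j. a \<le> j \<Longrightarrow> j \<le> b \<Longrightarrow> q \<noteq> p j"
    and t: "t \<noteq> c" "\<And>j. 0 < j \<Longrightarrow> j \<le> k \<Longrightarrow> t \<noteq> p j"
  shows 
    "\<not> (R q c \<and> 0 < b \<and> (\<forall>j. a \<le> j \<and> j \<le> b \<longrightarrow> (R q (p j) \<longleftrightarrow> j = b)))"
    "\<not> (R q c \<and> 0 < a \<and> (\<forall>j. a \<le> j \<and> j \<le> b \<longrightarrow> (R q (p j) \<longleftrightarrow> j = a)))"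
    "\<not> (\<not> R q c \<and> 0 < i \<and> a \<le> i \<and> i < b \<and> (\<forall>j. a \<le> j \<and> j \<le> b \<longrightarrow> (R q (p j) \<longleftrightarrow> j = i \<or> j = Suc i)))"
proof -
  let ?h = "close_up p c a b" and ?L = "b - a + 2"
  note hl = hole_close_up[OF R p c s(1,3,2)]
  have qn: "q \<notin> ?h ` {..<?L}" using close_up_notin[of a b q p c] q s(3) by auto
  note H = quasi_meyniel_house[OF Q hl _ qn]
  show "\<not> (R q c \<and> 0 < b \<and> (\<forall>j. a \<le> j \<and> j \<le> b \<longrightarrow> (R q (p j) \<longleftrightarrow> j = b)))"
  proof
    assume A: "R q c \<and> 0 < b \<and> (\<forall>j. a \<le> j \<and> j \<le> b \<longrightarrow> (R q (p j) \<longleftrightarrow> j = b))"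
    have "t = ?h (b-a) \<or> t = ?h (Suc (b-a) mod ?L)"
      by (rule H) (use A s in \<open>auto simp: close_up_def\<close>)
    then show False using A s t by (auto simp: close_up_def)
  qed
  show "\<not> (R q c \<and> 0 < a \<and> (\<forall>j. a \<le> j \<and> j \<le> b \<longrightarrow> (R q (p j) \<longleftrightarrow> j = a)))"
  proof
    assume A: "R q c \<and> 0 < a \<and> (\<forall>j. a \<le> j \<and> j \<le> b \<longrightarrow> (R q (p j) \<longleftrightarrow> j = a))"
    have "t = ?h (Suc (b-a)) \<or> t = ?h (Suc (Suc (b-a)) mod ?L)"
      by (rule H) (use A s in \<open>auto simp: close_up_def\<close>)
    then show False using A s t by (auto simp: close_up_def)
  qed
  show "\<not> (\<not> R q c \<and> 0 < i \<and> a \<le> i \<and> i < b \<and> (\<forall>j. a \<le> j \<and> j \<le> b \<longrightarrow> (R q (p j) \<longleftrightarrow> j = i \<or> j = Suc i)))"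
  proof
    assume A: "\<not> R q c \<and> 0 < i \<and> a \<le> i \<and> i < b \<and> (\<forall>j. a \<le> j \<and> j \<le> b \<longrightarrow> (R q (p j) \<longleftrightarrow> j = i \<or> j = Suc i))"
    have "t = ?h (i-a) \<or> t = ?h (Suc (i-a) mod ?L)"
      by (rule H) (use A s in \<open>auto simp: close_up_def\<close>)
    moreover have "?h (i-a) = p i" "?h (Suc (i-a) mod ?L) = p (Suc i)"
      using A by (auto simp: close_up_def)
    ultimately show False using A s t(2)[of i] t(2)[of "Suc i"] by auto
  qed
qed

lemma seg_next:
  assumes "R c (p k)" "R c (p a)" "a < k"
  obtains b where "seg R p c a b" "b \<le> k"
proof -
  define b where "b = (LEAST b. a < b \<and> R c (p b))"
  have "a < b \<and> R c (p b)" unfolding b_def by (rule LeastI[of _ k]) (use assms in auto)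
  moreover have "b \<le> k" unfolding b_def by (rule Least_le) (use assms in auto)
  moreover have "\<not> R c (p j)" if "a < j" "j < b" for j
    using not_less_Least[of j "\<lambda>b. a < b \<and> R c (p b)"] that unfolding b_def by auto
  ultimately have "seg R p c a b" "b \<le> k" using assms unfolding seg_def by auto
  then show thesis by (rule that)
qed

lemma seg_cover:
  assumes "R c (p 0)" "R c (p k)" "i < k"
  obtains a b where "seg R p c a b" "a \<le> i" "i < b" "b \<le> k"
proof -
  define S where "S = {a. a \<le> i \<and> R c (p a)}"
  have fin: "finite S" unfolding S_def by simp
  have "0 \<in> S" using assms unfolding S_def by simp
  then have M: "Max S \<in> S" using Max_in[OF fin] by blast
  then have M': "Max S \<le> i" "R c (p (Max S))" unfolding S_def by simp_all
  have ik: "Max S < k" using M' assms(3) by linarith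
  obtain b where b: "seg R p c (Max S) b" "b \<le> k"
    using seg_next[of R c p k "Max S", OF assms(2) M'(2) ik] by metis
  have b2: "Max S < b" "R c (p b)" using b(1) unfolding seg_def by simp_all
  have "i < b"
  proof (rule ccontr)
    assume "\<not> i < b"
    then have "b \<in> S" using b2 unfolding S_def by simp
    then have "b \<le> Max S" using fin by simp
    then show False using b2 by simp
  qed
  then show thesis using that[OF b(1) M'(1) _ b(2)] by simp
qed

lemma seg_prev:
  assumes "R c (p 0)" "R c (p b)" "0 < b"
  obtains a where "seg R p c a b"
proof -
  have "b - 1 < b" using assms(3) by simp
  then obtain a d where ad: "seg R p c a d" "a \<le> b - 1" "b - 1 < d" "d \<le> b"
    by (rule seg_cover[of R c p b "b - 1", OF assms(1,2)])
  then have "d = b" by linarith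
  then show thesis using that[of a] ad(1) by simp
qed

text \<open>A segment of length one next to a longer one is impossible: the remaining end of the short segment
  would see on the hole closed up by the long one exactly \<open>c\<close> and the shared end. So either all
  segments have length one, or none has, and then all are even.\<close>

lemma seg_dichotomy:
  assumes R: "symp R" "irreflp R" and Q: "quasi_meyniel R t"
    and p: "induced_path R p k" and c: "c \<notin> p ` {..k}"
    and t: "t \<noteq> c" "\<And>j. 0 < j \<Longrightarrow> j \<le> k \<Longrightarrow> t \<noteq> p j"
    and ends: "R c (p 0)" "R c (p k)"
  shows "(\<forall>j\<le>k. R c (p j)) \<or> (\<forall>a b. seg R p c a b \<and> b \<le> k \<longrightarrow> even (b - a))"
proof -
  have inj: "inj_on p {..k}" and adj: "\<And>i j. i \<le> k \<Longrightarrow> j \<le> k \<Longrightarrow> R (p i) (p j) \<longleftrightarrow> j = Suc i \<or> i = Suc j"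
    using p unfolding induced_path_def by auto
  have sy: "\<And>u v. R u v = R v u" using R(1) by (meson sympD)
  have iff: "b = Suc a \<longleftrightarrow> d = Suc b" if s: "seg R p c a b" "seg R p c b d" "d \<le> k" for a b d
  proof -
    have ab: "a < b" "b < d" "R c (p a)" "R c (p b)" "R c (p d)" using s unfolding seg_def by auto
    have pd: "\<And>i j. i \<le> k \<Longrightarrow> j \<le> k \<Longrightarrow> p i = p j \<longleftrightarrow> i = j" using inj_on_eq_iff[OF inj] by simp
    show ?thesis
    proof
      assume b: "b = Suc a"
      show "d = Suc b"
      proof (rule ccontr)
        assume "d \<noteq> Suc b"
        then have bd: "b + 2 \<le> d" using ab by auto
        have 1: "p a \<noteq> c" using c s(3) ab by auto
        have 2: "p a \<noteq> p j" if "b \<le> j" "j \<le> d" for j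
          using pd[of a j] that ab s(3) by simp
        have 3: "R (p a) (p j) \<longleftrightarrow> j = b" if "b \<le> j \<and> j \<le> d" for j
          using adj[of a j] that b ab s(3) by auto
        have 4: "R (p a) c" using sy ab(3) by blast
        show False
          using seg_house(2)[OF R Q p c s(2,3) bd 1 2 t] 3 4 ab(1) b by blast
      qed
    next
      assume b: "d = Suc b"
      show "b = Suc a"
      proof (rule ccontr)
        assume "b \<noteq> Suc a"
        then have bd: "a + 2 \<le> b" using ab by auto
        have 1: "p d \<noteq> c" using c s(3) ab by auto
        have 2: "p d \<noteq> p j" if "a \<le> j" "j \<le> b" for j
          using pd[of d j] that ab s(3) by simp
        have 3: "R (p d) (p j) \<longleftrightarrow> j = b" if "a \<le> j \<and> j \<le> b" for j
          using adj[of d j] that b ab s(3) by auto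
        have 4: "R (p d) c" using sy ab(5) by blast
        have "b \<le> k" "0 < b" using ab s(3) by auto
        then show False
          using seg_house(1)[OF R Q p c s(1) _ bd 1 2 t] 3 4 by blast
      qed
    qed
  qed
  show ?thesis
  proof (cases "1 \<le> k \<and> R c (p 1)")
    case True
    have "R c (p j)" if "j \<le> k" for j using that
    proof (induction j rule: less_induct)
      case (less j)
      show ?case
      proof (cases "j \<le> 1")
        case True
        then show ?thesis using ends \<open>1 \<le> k \<and> R c (p 1)\<close> by (cases j) auto
      next
        case False
        then have i: "j = Suc (Suc (j - 2))" by simp
        define i where "i = j - 2"
        with i have i: "j = Suc (Suc i)" by simp
        have 1: "R c (p i)" "R c (p (Suc i))"
          using less.IH[of i] less.IH[of "Suc i"] less.prems i by simp_all
        have s: "seg R p c i (Suc i)" using 1 unfolding seg_def by auto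
        have "Suc i < k" using less.prems i by simp
        then obtain d where d: "seg R p c (Suc i) d" "d \<le> k"
          by (rule seg_next[of R c p k "Suc i", OF ends(2) 1(2)])
        then have "d = j" using iff[OF s d] i by blast
        then show ?thesis using d unfolding seg_def by auto
      qed
    qed
    then show ?thesis by auto
  next
    case False
    have "b \<noteq> Suc a" if "seg R p c a b" "b \<le> k" for a b using that
    proof (induction a arbitrary: b rule: less_induct)
      case (less a)
      show ?case
      proof (cases "a = 0")
        case True
        have "1 \<le> k" "R c (p b)" using less.prems unfolding seg_def by simp_all
        then show ?thesis using True False by auto
      next
        case F: False
        have "R c (p a)" "0 < a" using less.prems(1) F unfolding seg_def by simp_all
        then obtain a' where a': "seg R p c a' a" by (rule seg_prev[of R c p a, OF ends(1)])
        have "a' < a" "a \<le> k" using a' less.prems(1,2) unfolding seg_def by auto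
        then have "a \<noteq> Suc a'" using less.IH a' by blast
        then show ?thesis using iff[OF a' less.prems] by blast
      qed
    qed
    then have "even (b - a)" if "seg R p c a b" "b \<le> k" for a b
      using seg_parity[OF R Q p c that] that by blast
    then show ?thesis by blast
  qed
qed

lemma seg_even_index:
  assumes "R c (p 0)" "\<And>a b. seg R p c a b \<Longrightarrow> b \<le> k \<Longrightarrow> even (b - a)"
    and "j \<le> k" "R c (p j)"
  shows "even j"
  using assms(3,4)
proof (induction j rule: less_induct)
  case (less j)
  show ?case
  proof (cases "j = 0")
    case False
    then have "0 < j" by simp
    then obtain a where a: "seg R p c a j" by (rule seg_prev[of R c p j, OF assms(1) less.prems(2)])
    then have "a < j" "R c (p a)" unfolding seg_def by auto
    then have "even a" using less.IH[of a] less.prems by simp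
    moreover have "even (j - a)" using assms(2)[OF a less.prems(1)] .
    ultimately show ?thesis using \<open>a < j\<close> by auto
  qed auto
qed

section \<open>Even pairs\<close>

text \<open>A non-neighbour \<open>z\<close> of \<open>t\<close> whose set of common neighbours with \<open>t\<close> is maximal with respect to
  inclusion.\<close>

definition best_partner :: "('a \<Rightarrow> 'a \<Rightarrow> bool) \<Rightarrow> 'a \<Rightarrow> 'a \<Rightarrow> bool" where
  "best_partner R t z \<longleftrightarrow> z \<noteq> t \<and> \<not> R t z \<and>
     (\<forall>u. u \<noteq> t \<and> \<not> R t u \<longrightarrow> \<not> {x. R t x \<and> R z x} \<subset> {x. R t x \<and> R u x})"

text \<open>The vertex \<open>p 2\<close> is not adjacent to \<open>t\<close> and shares with it the neighbour \<open>p 1\<close>, which \<open>z\<close> does not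
  see. By maximality \<open>z\<close> and \<open>t\<close> have a common neighbour \<open>c\<close> that \<open>p 2\<close> does not see.\<close>

lemma best_partner_apex:
  assumes R: "symp R" "irreflp R" and Q: "quasi_meyniel R t" and z: "best_partner R t z"
    and p: "induced_path R p k" "p 0 = t" "p k = z" "3 \<le> k"
  obtains c where "R t c" "R z c" "\<not> R c (p 2)" "c \<notin> p ` {..k}"
    "\<And>a b. seg R p c a b \<Longrightarrow> b \<le> k \<Longrightarrow> even (b - a)"
proof -
  have inj: "inj_on p {..k}" and adj: "\<And>i j. i \<le> k \<Longrightarrow> j \<le> k \<Longrightarrow> R (p i) (p j) \<longleftrightarrow> j = Suc i \<or> i = Suc j"
    using p unfolding induced_path_def by auto
  have sy: "\<And>u v. R u v = R v u" using R(1) by (meson sympD)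
  have irr: "\<And>u. \<not> R u u" using R(2) by (meson irreflpD)
  have "p 2 \<noteq> t" using inj_onD[OF inj, of 2 0] p by auto
  moreover have "\<not> R t (p 2)" using adj[of 0 2] p by auto
  ultimately have "\<not> {x. R t x \<and> R z x} \<subset> {x. R t x \<and> R (p 2) x}" using z unfolding best_partner_def by blast
  moreover have "R t (p 1)" "R (p 2) (p 1)" "\<not> R z (p 1)"
    using adj[of 0 1] adj[of 2 1] adj[of k 1] p by auto
  ultimately obtain c where c: "R t c" "R z c" "\<not> R (p 2) c" by blast
  have cp: "c \<notin> p ` {..k}"
  proof
    assume "c \<in> p ` {..k}"
    then obtain i where i: "i \<le> k" "c = p i" by auto
    then show False using c adj[of 0 i] adj[of k i] p by auto
  qed
  have ends: "R c (p 0)" "R c (p k)" using c p sy by auto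
  have t: "t \<noteq> c" using c irr by auto
  have t2: "\<And>j. 0 < j \<Longrightarrow> j \<le> k \<Longrightarrow> t \<noteq> p j" using inj_onD[OF inj, of 0] p by force
  have "\<not> (\<forall>j\<le>k. R c (p j))" using c sy p(4) by (metis numeral_2_eq_2 numeral_3_eq_3 Suc_leD)
  then have "\<forall>a b. seg R p c a b \<and> b \<le> k \<longrightarrow> even (b - a)"
    using seg_dichotomy[OF R Q p(1) cp t t2 ends] by auto
  then show thesis using that c cp sy by blast
qed

lemma best_partner_even_pair:
  assumes R: "symp R" "irreflp R" and Q: "quasi_meyniel R t" and z: "best_partner R t z"
    and p: "induced_path R p k" "p 0 = t" "p k = z"
  shows "even k"
proof (rule ccontr)
  assume o: "odd k"
  have sy: "\<And>u v. R u v = R v u" using R(1) by (meson sympD)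
  have "k \<noteq> 1"
  proof
    assume "k = 1"
    then have "R (p 0) (p k)" using p(1) unfolding induced_path_def by auto
    then show False using p z unfolding best_partner_def by auto
  qed
  then have k: "3 \<le> k" using o by (metis One_nat_def Suc_leI even_Suc even_zero le_neq_implies_less numeral_3_eq_3 not_less_eq_eq odd_pos Suc_1)
  obtain c where c: "R t c" "R z c" "\<not> R c (p 2)" "c \<notin> p ` {..k}"
    "\<And>a b. seg R p c a b \<Longrightarrow> b \<le> k \<Longrightarrow> even (b - a)"
    using best_partner_apex[OF R Q z p k] by blast
  have "even k" by (rule seg_even_index[where k=k and R=R and c=c and p=p]) (use c p sy in auto)
  then show False using o by simp
qed

text \<open>This is the configuration to which a forbidden vertex \<open>q\<close> seeing two consecutive vertices of a hole
  opens up when \<open>t\<close> and \<open>z\<close> are separated again.\<close>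

lemma no_roofed_path:
  assumes R: "symp R" "irreflp R" and Q: "quasi_meyniel R t" and z: "best_partner R t z"
    and p: "induced_path R p k" "p 0 = t" "p k = z" "4 \<le> k"
    and q: "q \<notin> p ` {..k}" and i: "1 \<le> i" "i + 1 < k"
    and qn: "\<And>j. j \<le> k \<Longrightarrow> R q (p j) \<longleftrightarrow> j = i \<or> j = Suc i"
  shows False
proof -
  have inj: "inj_on p {..k}" and adj: "\<And>i j. i \<le> k \<Longrightarrow> j \<le> k \<Longrightarrow> R (p i) (p j) \<longleftrightarrow> j = Suc i \<or> i = Suc j"
    using p unfolding induced_path_def by auto
  have sy: "\<And>u v. R u v = R v u" using R(1) by (meson sympD)
  have irr: "\<And>u. \<not> R u u" using R(2) by (meson irreflpD)
  obtain c where c: "R t c" "R z c" "\<not> R c (p 2)" and cp: "c \<notin> p ` {..k}"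
    and ev: "\<And>a b. seg R p c a b \<Longrightarrow> b \<le> k \<Longrightarrow> even (b - a)"
    using best_partner_apex[OF R Q z p(1-3)] p(4) by auto
  have ends: "R c (p 0)" "R c (p k)" using c p sy by auto
  have t: "t \<noteq> c" using c irr by auto
  have t2: "\<And>j. 0 < j \<Longrightarrow> j \<le> k \<Longrightarrow> t \<noteq> p j" using inj_onD[OF inj, of 0] p by force
  have qc: "q \<noteq> c" using qn[of 0] i c sy p by auto
  have qp: "\<And>j. j \<le> k \<Longrightarrow> q \<noteq> p j" using q by auto
  have ge2: "a + 2 \<le> b" if "seg R p c a b" "b \<le> k" for a b
  proof -
    have "a < b" "even (b - a)" using that ev unfolding seg_def by auto
    then show ?thesis by presburger
  qed
  note sh = seg_house[OF R Q p(1) cp _ _ ge2 qc _ t t2]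
  show False
  proof (cases "R q c")
    case False
    \<comment> \<open>Here \<open>q\<close> sees just the edge \<open>p i, p (i + 1)\<close> of the hole through the segment containing it.\<close>
    obtain a b where ab: "seg R p c a b" "a \<le> i" "i < b" "b \<le> k"
      using seg_cover[of R c p k i] ends i by auto
    show False using sh(3)[OF ab(1,4,1,4), of i] False ab i qp qn by auto
  next
    case True
    consider "R c (p i)" | "R c (p (Suc i))" | "\<not> R c (p i)" "\<not> R c (p (Suc i))" by blast
    then show False
    proof cases
      case 1
      \<comment> \<open>The segment ending at \<open>p i\<close> gives a hole on which \<open>q\<close> sees only \<open>c\<close> and \<open>p i\<close>; the next case is
        symmetric.\<close>
      obtain a where a: "seg R p c a i" using seg_prev[of R c p i] 1 ends i by auto
      then show False using sh(1)[OF a _ a] True i qp qn by auto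
    next
      case 2
      obtain b where b: "seg R p c (Suc i) b" "b \<le> k" using seg_next[of R c p k "Suc i"] 2 ends i by auto
      then show False using sh(2)[OF b b] True i qp qn by auto
    next
      case 3
      obtain a b where ab: "seg R p c a b" "a \<le> i" "i < b" "b \<le> k"
        using seg_cover[of R c p k i] ends i by auto
      have ai: "a < i" "Suc i < b" using ab 3 unfolding seg_def
        by (metis le_neq_implies_less, metis Suc_lessI)
      \<comment> \<open>The segment around the edge \<open>p i, p (i + 1)\<close>, rerouted through \<open>q\<close>, is cut by the edge \<open>q c\<close> into
        two segments of total length \<open>b - a + 1\<close>, an odd number, and neither has length one.\<close>
      let ?p1 = "\<lambda>j. if j \<le> i then p j else q" and ?p2 = "\<lambda>j. if j = 0 then q else p (i + j)"
      have adj': "R (p j) q \<longleftrightarrow> j = i \<or> j = Suc i" if "j \<le> k" for j using qn that sy by blast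
      have pd: "\<And>i j. i \<le> k \<Longrightarrow> j \<le> k \<Longrightarrow> p i = p j \<longleftrightarrow> i = j" using inj_on_eq_iff[OF inj] by simp
      have inj1: "x = y" if "x \<le> Suc i" "y \<le> Suc i" "?p1 x = ?p1 y" for x y
        using that i qp[of x] qp[of y] pd[of x y] by (simp split: if_splits)
      have adj1: "R (?p1 x) (?p1 y) \<longleftrightarrow> y = Suc x \<or> x = Suc y" if "x \<le> Suc i" "y \<le> Suc i" for x y
        using that i adj[of x y] adj'[of x] qn[of y] irr[of q] by (cases "x \<le> i"; cases "y \<le> i") auto
      have p1: "induced_path R ?p1 (Suc i)"
        by (rule induced_pathI, fact inj1, fact adj1)
      have inj2: "x = y" if "x \<le> k - i" "y \<le> k - i" "?p2 x = ?p2 y" for x y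
      proof -
        have "i + x \<le> k" "i + y \<le> k" using that i by linarith+
        then show ?thesis
          using that i qp[of "i + x"] qp[of "i + y"] pd[of "i + x" "i + y"] by (simp split: if_splits)
      qed
      have adj2: "R (?p2 x) (?p2 y) \<longleftrightarrow> y = Suc x \<or> x = Suc y" if "x \<le> k - i" "y \<le> k - i" for x y
      proof -
        have "i + x \<le> k" "i + y \<le> k" using that i by linarith+
        then show ?thesis
          using that i adj[of "i + x" "i + y"] adj'[of "i + x"] qn[of "i + y"] irr[of q]
          by (cases "x = 0"; cases "y = 0") auto
      qed
      have p2: "induced_path R ?p2 (k - i)"
        by (rule induced_pathI, fact inj2, fact adj2)
      have cp': "c \<noteq> p j" if "j \<le> k" for j using cp that by blast
      have c1: "c \<notin> ?p1 ` {..Suc i}"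
        using cp' qc i by (auto simp: image_iff split: if_splits)
      have c2: "c \<notin> ?p2 ` {..k - i}"
      proof
        assume "c \<in> ?p2 ` {..k - i}"
        then obtain j where j: "j \<le> k - i" "c = ?p2 j" by blast
        then have "i + j \<le> k" using i by linarith
        then show False using j cp'[of "i + j"] qc i by (simp split: if_splits)
      qed
      have cq: "R c q" using True sy by blast
      have s1: "seg R ?p1 c a (Suc i)" using ab ai cq unfolding seg_def by simp
      have s2: "seg R ?p2 c 0 (b - i)"
      proof -
        have "\<forall>j. 0 < j \<and> j < b - i \<longrightarrow> \<not> R c (p (i + j))"
          using ab ai unfolding seg_def by auto
        then show ?thesis using ab ai cq unfolding seg_def by simp
      qed
      have "even (Suc i - a)" using seg_parity[OF R Q p1 c1 s1] ai by auto
      moreover have "even (b - i)"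
      proof -
        have "b - i \<noteq> Suc 0" using ai by linarith
        then show ?thesis using seg_parity[OF R Q p2 c2 s2] diff_le_mono[OF ab(4), of i] by simp
      qed
      moreover have "even (b - a)" using ev[OF ab(1,4)] .
      ultimately show False using ai by presburger
    qed
  qed
qed

section \<open>Contraction of an even pair\<close>

lemma hole_cong:
  assumes "hole R h L" "\<And>i j. i < L \<Longrightarrow> j < L \<Longrightarrow> R (h i) (h j) \<longleftrightarrow> R' (h i) (h j)"
  shows "hole R' h L"
  using assms unfolding hole_def by simp

lemma hole_rotate:
  assumes "hole R h L"
  shows "hole R (\<lambda>i. h ((i + r) mod L)) L"
proof -
  have L: "4 \<le> L" and inj: "inj_on h {..<L}"
    and adj: "\<And>i j. i < L \<Longrightarrow> j < L \<Longrightarrow> R (h i) (h j) \<longleftrightarrow> j = Suc i mod L \<or> i = Suc j mod L"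
    using assms unfolding hole_def by auto
  have eq: "(i + r) mod L = (j + r) mod L \<longleftrightarrow> i mod L = j mod L" for i j
    by (simp add: nat_mod_eq_iff)
  have 1: "inj_on (\<lambda>i. h ((i + r) mod L)) {..<L}"
  proof (rule inj_onI)
    fix x y assume xy: "x \<in> {..<L}" "y \<in> {..<L}" "h ((x + r) mod L) = h ((y + r) mod L)"
    then have "(x + r) mod L = (y + r) mod L" using inj_onD[OF inj xy(3)] L by simp
    then show "x = y" using eq xy by simp
  qed
  have 2: "(j + r) mod L = Suc ((i + r) mod L) mod L \<longleftrightarrow> j = Suc i mod L" if "j < L" for i j
    using eq[of j "Suc i"] that by (simp add: mod_simps)
  show ?thesis unfolding hole_def using 1 2 L adj by auto
qed

lemma hole_reflect:
  assumes "hole R h L"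
  shows "hole R (\<lambda>i. if i = 0 then h 0 else h (L - i)) L"
proof -
  have L: "4 \<le> L" and inj: "inj_on h {..<L}"
    and adj: "\<And>i j. i < L \<Longrightarrow> j < L \<Longrightarrow> R (h i) (h j) \<longleftrightarrow> j = Suc i mod L \<or> i = Suc j mod L"
    using assms unfolding hole_def by auto
  have 1: "i = j" if "i < L" "j < L" "(if i = 0 then h 0 else h (L - i)) = (if j = 0 then h 0 else h (L - j))" for i j
  proof -
    have e: "h i = h j \<longleftrightarrow> i = j" if "i < L" "j < L" for i j
      using inj_on_eq_iff[OF inj] that by simp
    consider "i = 0" "j = 0" | "i = 0" "0 < j" | "0 < i" "j = 0" | "0 < i" "0 < j" by auto
    then show ?thesis
    proof cases
      case 2
      then show ?thesis using e[of 0 "L - j"] that by simp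
    next
      case 3
      then show ?thesis using e[of "L - i" 0] that by simp
    next
      case 4
      then have "L - i = L - j" using e[of "L - i" "L - j"] that by simp
      then show ?thesis using that by linarith
    qed simp
  qed
  have 2: "R (if i = 0 then h 0 else h (L - i)) (if j = 0 then h 0 else h (L - j)) \<longleftrightarrow>
      j = Suc i mod L \<or> i = Suc j mod L" if "i < L" "j < L" for i j
  proof -
    consider "i = 0" "j = 0" | "i = 0" "0 < j" | "0 < i" "j = 0" | "0 < i" "0 < j" by auto
    then show ?thesis
    proof cases
      case 1
      then show ?thesis using adj[of 0 0] L by simp
    next
      case 2
      then show ?thesis using adj[of 0 "L - j"] that L by (auto simp: Suc_mod_eq)
    next
      case 3
      then show ?thesis using adj[of "L - i" 0] that L by (auto simp: Suc_mod_eq)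
    next
      case 4
      have m: "L - j = Suc (L - i) mod L \<longleftrightarrow> i = Suc j mod L" if "0 < i" "0 < j" "i < L" "j < L" for i j
      proof (cases "i = 1 \<or> Suc j = L")
        case True
        have "Suc (L - i) mod L = (if i = 1 then 0 else Suc (L - i))"
          using Suc_mod_eq[of "L - i" L] that by auto
        moreover have "Suc j mod L = (if Suc j = L then 0 else Suc j)"
          using Suc_mod_eq[of j L] that by simp
        ultimately show ?thesis using True that by auto
      next
        case False
        then have "Suc (L - i) < L" "Suc j < L" using that by linarith+
        then have "Suc (L - i) mod L = Suc (L - i)" "Suc j mod L = Suc j" by simp_all
        then show ?thesis using that by linarith
      qed
      show ?thesis using adj[of "L - i" "L - j"] m[of i j] m[of j i] 4 that by auto
    qed
  qed
  show ?thesis by (rule holeI, fact L, fact 1, fact 2)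
qed

text \<open>The vertex \<open>z\<close> is contracted into \<open>t\<close>, which inherits its neighbours; \<open>z\<close> itself becomes
  isolated.\<close>

definition contract :: "('a \<Rightarrow> 'a \<Rightarrow> bool) \<Rightarrow> 'a \<Rightarrow> 'a \<Rightarrow> 'a \<Rightarrow> 'a \<Rightarrow> bool" where
  "contract R t z u v \<longleftrightarrow> u \<noteq> z \<and> v \<noteq> z \<and> (R u v \<or> u = t \<and> R z v \<or> v = t \<and> R u z)"

lemma hole_has_neighbour:
  assumes "hole R h L" "i < L"
  shows "R (h i) (h (Suc i mod L))"
  using assms unfolding hole_def by auto

text \<open>Separating \<open>t\<close> and \<open>z\<close> again, a hole of the contracted graph through \<open>t\<close> stays a hole, through \<open>t\<close>
  or through \<open>z\<close>, or it opens up to an induced path from \<open>t\<close> to \<open>z\<close>, run through in one direction or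
  the other.\<close>

lemma contract_hole:
  assumes R: "symp R" "irreflp R" and tz: "t \<noteq> z" "\<not> R t z"
    and h: "hole (contract R t z) h L" and h0: "h 0 = t"
  shows "hole R h L \<or> hole R (h(0 := z)) L \<or>
    induced_path R (h(L := z)) L \<or>
    induced_path R ((\<lambda>i. if i = 0 then h 0 else h (L - i))(L := z)) L"
proof -
  let ?R = "contract R t z"
  have sy: "R u v \<Longrightarrow> R v u" for u v using R(1) by (meson sympD)
  have irr: "\<not> R u u" for u using R(2) by (meson irreflpD)
  have nz: "g i \<noteq> z" if "hole ?R g L" "i < L" for g i
    using hole_has_neighbour[OF that] unfolding contract_def by blast
  have adjh: "?R (g i) (g j) \<longleftrightarrow> j = Suc i mod L \<or> i = Suc j mod L" if "hole ?R g L" "i < L" "j < L" for g i j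
    using that unfolding hole_def by blast
  have inj: "g i = g j \<longleftrightarrow> i = j" if "hole ?R g L" "i < L" "j < L" for g i j
    using that inj_on_eq_iff[of g "{..<L}" i j] unfolding hole_def by simp
  have L: "4 \<le> L" using h unfolding hole_def by simp
  have gt: "R t (g j) \<or> R z (g j) \<longleftrightarrow> j = 1 \<or> j = L - 1" if "hole ?R g L" "g 0 = t" "j < L" for g j
  proof -
    have "?R t (g j) \<longleftrightarrow> j = 1 \<or> j = L - 1"
      using adjh[OF that(1), of 0 j] that L by (auto simp: Suc_mod_eq)
    moreover have "?R t (g j) \<longleftrightarrow> R t (g j) \<or> R z (g j)"
      using nz[OF that(1,3)] tz inj[OF that(1,3), of 0] that sy irr unfolding contract_def by blast
    ultimately show ?thesis by simp
  qed
  have inner: "R (g i) (g j) \<longleftrightarrow> j = Suc i mod L \<or> i = Suc j mod L"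
    if "hole ?R g L" "g 0 = t" "0 < i" "0 < j" "i < L" "j < L" for g i j
    using adjh[OF that(1,5,6)] nz[OF that(1,5)] nz[OF that(1,6)]
      inj[OF that(1,5), of 0] inj[OF that(1,6), of 0] that
    unfolding contract_def by auto
  have opened: "induced_path R (g(L := z)) L"
    if g: "hole ?R g L" "g 0 = t" and nb: "\<not> R t (g (L - 1))" "\<not> R z (g 1)" for g
  proof (rule induced_pathI)
    fix x y assume "x \<le> L" "y \<le> L" "(g(L := z)) x = (g(L := z)) y"
    then show "x = y" using nz[OF g(1), of x] nz[OF g(1), of y] inj[OF g(1), of x y]
      by (auto split: if_splits)
  next
    fix x y assume xy: "x \<le> L" "y \<le> L"
    have 1: "R t (g j) \<longleftrightarrow> j = 1" "R z (g j) \<longleftrightarrow> j = L - 1" if "j < L" for j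
      using gt[OF g that] gt[OF g, of 1] gt[OF g, of "L - 1"] nb L by auto
    have 2: "R (g j) t \<longleftrightarrow> j = 1" "R (g j) z \<longleftrightarrow> j = L - 1" if "j < L" for j
      using 1[OF that] sy by blast+
    consider "x = L" "y = L" | "x = L" "y < L" | "x < L" "y = L" | "x < L" "y < L" using xy by linarith
    then show "R ((g(L := z)) x) ((g(L := z)) y) \<longleftrightarrow> y = Suc x \<or> x = Suc y"
    proof cases
      case 4
      consider "x = 0" | "y = 0" | "0 < x" "0 < y" by auto
      then show ?thesis
        using 4 1(1)[of y] 2(1)[of x] g inner[OF g, of x y]
        by cases (auto simp: Suc_mod_eq irr)
    qed (use 1[of y] 2[of x] irr[of z] L in auto)
  qed
  have full: "hole R (h(0 := w)) L" if w: "w = t \<or> w = z" "R w (h 1)" "R w (h (L - 1))" for w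
  proof -
    have 1: "x = y" if "x < L" "y < L" "(h(0 := w)) x = (h(0 := w)) y" for x y
      using that nz[OF h, of x] nz[OF h, of y] inj[OF h, of x y] w(1) h0
        inj[OF h, of 0 x] inj[OF h, of 0 y] by (auto split: if_splits)
    have 2: "R w (h j) \<longleftrightarrow> j = 1 \<or> j = L - 1" if "0 < j" "j < L" for j
      using gt[OF h h0 that(2)] w by auto
    have 3: "R (h j) w \<longleftrightarrow> j = 1 \<or> j = L - 1" if "0 < j" "j < L" for j
      using 2[OF that] sy by blast
    have 4: "R ((h(0 := w)) x) ((h(0 := w)) y) \<longleftrightarrow> y = Suc x mod L \<or> x = Suc y mod L"
      if "x < L" "y < L" for x y
    proof -
      consider "x = 0" "y = 0" | "x = 0" "0 < y" | "0 < x" "y = 0" | "0 < x" "0 < y" by auto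
      then show ?thesis
        using that 2[of y] 3[of x] irr[of w] inner[OF h h0, of x y] L
        by cases (auto simp: Suc_mod_eq)
    qed
    show ?thesis by (rule holeI, fact L, fact 1, fact 4)
  qed
  let ?r = "\<lambda>i. if i = 0 then h 0 else h (L - i)"
  have r: "hole ?R ?r L" "?r 0 = t" using hole_reflect[OF h] h0 by simp_all
  have eq: "?r 1 = h (L - 1)" "?r (L - 1) = h 1" "h(0 := t) = h" using L h0 by auto
  have "R t (h 1) \<or> R z (h 1)" "R t (h (L - 1)) \<or> R z (h (L - 1))"
    using gt[OF h h0, of 1] gt[OF h h0, of "L - 1"] L by auto
  then consider "R t (h 1)" "R t (h (L - 1))" | "R z (h 1)" "R z (h (L - 1))"
    | "\<not> R t (h (L - 1))" "\<not> R z (h 1)" | "\<not> R t (h 1)" "\<not> R z (h (L - 1))" by blast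
  then show ?thesis
  proof cases
    case 1
    then show ?thesis using full[of t] eq by simp
  next
    case 2
    then show ?thesis using full[of z] by simp
  next
    case 3
    then show ?thesis using opened[OF h h0] by simp
  next
    case 4
    then have "\<not> R t (?r (L - 1))" "\<not> R z (?r 1)" unfolding eq by simp_all
    then show ?thesis using opened[OF r] by blast
  qed
qed

lemma quasi_meyniel_contract:
  assumes R: "symp R" "irreflp R" and Q: "quasi_meyniel R t" and z: "best_partner R t z"
  shows "quasi_meyniel (contract R t z) t"
proof -
  let ?R = "contract R t z"
  have sy: "R u v \<Longrightarrow> R v u" for u v using R(1) by (meson sympD)
  have irr: "\<not> R u u" for u using R(2) by (meson irreflpD)
  have tz: "t \<noteq> z" "\<not> R t z" using z unfolding best_partner_def by auto
  have nz: "h i \<noteq> z" if "hole ?R h L" "i < L" for h i L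
    using hole_has_neighbour[OF that] unfolding contract_def by blast
  have off: "hole R h L" if h: "hole ?R h L" "t \<notin> h ` {..<L}" for h L
  proof (rule hole_cong[OF h(1)])
    fix i j assume ij: "i < L" "j < L"
    then have "h i \<noteq> t" "h j \<noteq> t" using h(2) by auto
    then show "?R (h i) (h j) \<longleftrightarrow> R (h i) (h j)"
      using nz[OF h(1)] ij unfolding contract_def by simp
  qed
  \<comment> \<open>An induced path \<open>t, x, y, z\<close> would have the odd length three.\<close>
  have no_p4: False if "R t x" "\<not> R t y" "R z y" "\<not> R z x" "R x y" for x y
  proof -
    let ?p = "(!) [t, x, y, z]"
    have ne: "t \<noteq> x" "t \<noteq> y" "t \<noteq> z" "x \<noteq> y" "x \<noteq> z" "y \<noteq> z" using that tz irr sy by blast+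
    have ns: "R x t" "\<not> R y t" "R y z" "\<not> R x z" "R y x" "\<not> R z t" using that tz sy by blast+
    have p: "?p 0 = t" "?p 1 = x" "?p 2 = y" "?p 3 = z" by simp_all
    have le: "j \<in> {0, 1, 2, 3}" if "j \<le> 3" for j :: nat using that by auto
    have "\<forall>i\<in>{0,1,2,3}. \<forall>j\<in>{0,1,2,3}. ?p i = ?p j \<longrightarrow> i = j"
      unfolding ball_simps p using ne by metis
    moreover have "\<forall>i\<in>{0,1,2,3}. \<forall>j\<in>{0,1,2,3}. R (?p i) (?p j) \<longleftrightarrow> j = Suc i \<or> i = Suc j"
      unfolding ball_simps p by (simp add: that ns tz irr)
    ultimately have "induced_path R ?p 3"
      unfolding induced_path_def inj_on_def using le by blast
    then show False using best_partner_even_pair[OF R Q z, of ?p 3] by simp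
  qed
  show ?thesis unfolding quasi_meyniel_def
  proof (intro conjI allI impI)
    fix h L assume h: "hole ?R h L"
    show "even L"
    proof (cases "t \<in> h ` {..<L}")
      case False
      then show ?thesis using quasi_meyniel_even_hole[OF Q off[OF h]] by blast
    next
      case True
      then obtain r where r: "r < L" "h r = t" by auto
      let ?g = "\<lambda>i. h ((i + r) mod L)"
      have g: "hole ?R ?g L" using hole_rotate[OF h] .
      have L: "4 \<le> L" using h unfolding hole_def by simp
      have g0: "?g 0 = t" using r by simp
      have ev: "even L" if "induced_path R p L" "p 0 = t" "p L = z" for p
        using best_partner_even_pair[OF R Q z that] .
      let ?r = "\<lambda>i. if i = 0 then ?g 0 else ?g (L - i)"
      have "(?g(L := z)) 0 = t" "(?g(L := z)) L = z" "(?r(L := z)) 0 = t" "(?r(L := z)) L = z"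
        using g0 L by simp_all
      then show ?thesis
        using contract_hole[OF R tz g g0] quasi_meyniel_even_hole[OF Q] ev by blast
    qed
  next
    fix h L q i assume A: "hole ?R h L \<and> i < L \<and> q \<notin> h ` {..<L} \<and>
       (\<forall>j<L. ?R q (h j) = (j = i \<or> j = Suc i mod L))"
    show "t = h i \<or> t = h (Suc i mod L)"
    proof (rule ccontr)
      assume nt: "\<not> ?thesis"
      have h: "hole ?R h L" and i: "i < L" and q: "q \<notin> h ` {..<L}"
        and qn: "\<And>j. j < L \<Longrightarrow> ?R q (h j) \<longleftrightarrow> j = i \<or> j = Suc i mod L" using A by auto
      have L: "4 \<le> L" using h unfolding hole_def by simp
      have qz: "q \<noteq> z" using qn[of i] i unfolding contract_def by blast
      show False
      proof (cases "t \<in> h ` {..<L}")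
        case False
        note hR = off[OF h False]
        have hz: "h j \<noteq> z" "h j \<noteq> t" if "j < L" for j using nz[OF h that] False that by auto
        show False
        proof (cases "q = t")
          case False
          have "R q (h j) \<longleftrightarrow> j = i \<or> j = Suc i mod L" if "j < L" for j
            using qn[OF that] hz[OF that] qz False unfolding contract_def by simp
          then show False using quasi_meyniel_house[OF Q hR i q] nt by blast
        next
          case True
          have tn: "R t (h j) \<or> R z (h j) \<longleftrightarrow> j = i \<or> j = Suc i mod L" if "j < L" for j
            using qn[OF that] hz[OF that] tz True unfolding contract_def by simp
          let ?k = "Suc i mod L"
          have k: "?k < L" using L by simp
          have ik: "R (h i) (h ?k)" "R (h ?k) (h i)" using hole_has_neighbour[OF hR i] sy by auto
          have not_both: "\<not> (R w (h i) \<and> R w (h ?k))" if w: "w = t \<or> w = z" for w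
          proof
            assume B: "R w (h i) \<and> R w (h ?k)"
            have "w \<notin> h ` {..<L}" using hz w by blast
            moreover have "R w (h j) \<longleftrightarrow> j = i \<or> j = ?k" if "j < L" for j
              using tn[OF that] B w by blast
            ultimately show False using quasi_meyniel_house[OF Q hR i] nt by blast
          qed
          show False
            using not_both[of t] not_both[of z] tn[OF i] tn[OF k] ik
              no_p4[of "h i" "h ?k"] no_p4[of "h ?k" "h i"] by blast
        qed
      next
        case True
        then obtain r where r: "r < L" "h r = t" by auto
        \<comment> \<open>Rotate the hole so that \<open>t\<close> comes first; \<open>i'\<close> is the new position of the edge seen by \<open>q\<close>.\<close>
        let ?g = "\<lambda>j. h ((j + r) mod L)"
        have g: "hole ?R ?g L" using hole_rotate[OF h] .
        have g0: "?g 0 = t" using r by simp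
        have rot: "(j + r) mod L = (k + r) mod L \<longleftrightarrow> j = k" if "j < L" "k < L" for j k
          using hole_rotate[OF h, of r] that inj_on_eq_iff[of ?g "{..<L}" j k] inj_on_eq_iff[of h "{..<L}"] h
          unfolding hole_def by (metis (no_types, lifting) lessThan_iff)
        define i' where "i' = (i + (L - r)) mod L"
        have i': "i' < L" "(i' + r) mod L = i" unfolding i'_def using L r i by (simp_all add: mod_simps)
        have i'': "(Suc i' + r) mod L = Suc i mod L"
          using i'(2) by (metis add_Suc mod_Suc_eq)
        have gn: "?R q (?g j) \<longleftrightarrow> j = i' \<or> j = Suc i' mod L" if "j < L" for j
        proof -
          have "?R q (?g j) \<longleftrightarrow> (j + r) mod L = (i' + r) mod L \<or> (j + r) mod L = (Suc i' mod L + r) mod L"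
            using qn[of "(j + r) mod L"] L i'(2) i'' by (simp add: mod_simps)
          then show ?thesis using rot[OF that i'(1)] rot[OF that, of "Suc i' mod L"] L by simp
        qed
        have gnt: "t \<noteq> ?g i'" "t \<noteq> ?g (Suc i' mod L)" using nt i'(2) i'' by (simp_all add: mod_simps)
        have in1: "1 \<le> i'" using gnt(1) g0 by (cases i') auto
        have in2: "i' + 1 < L" using gnt(2) g0 i'(1) by (cases "Suc i' = L") auto
        have sm: "Suc i' mod L = Suc i'" using in2 by simp
        have qg: "q \<noteq> ?g j" for j using q L by auto
        have qt: "q \<noteq> t" using qg[of 0] g0 by simp
        have gz: "?g j \<noteq> z" if "j < L" for j using nz[OF g that] .
        have gt: "?g j \<noteq> t" if "0 < j" "j < L" for j
          using g0 rot[of j 0] that inj_on_eq_iff[of ?g "{..<L}" j 0] g unfolding hole_def by auto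
        have qR: "R q (?g j) \<longleftrightarrow> j = i' \<or> j = Suc i'" if "0 < j" "j < L" for j
          using gn[OF that(2)] gz[OF that(2)] gt[OF that] qt qz sm unfolding contract_def by simp
        have "\<not> ?R q t" using gn[of 0] g0 in1 sm L by simp
        then have qR0: "\<not> R q t" "\<not> R q z" using qz tz unfolding contract_def by auto
        have full: False if w: "w = t \<or> w = z" and hw: "hole R (?g(0 := w)) L" for w
        proof -
          have 1: "q \<notin> (?g(0 := w)) ` {..<L}" using qg qt qz w by (auto simp: image_iff)
          have 2: "R q ((?g(0 := w)) j) \<longleftrightarrow> j = i' \<or> j = Suc i' mod L" if "j < L" for j
            using qR[of j] that qR0 w in1 sm by (cases "j = 0") auto
          show False using quasi_meyniel_house[OF Q hw i'(1) 1 2] gnt in1 sm by auto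
        qed
        have opened: False
          if p: "induced_path R p L" "p 0 = t" "p L = z" "1 \<le> k" "k + 1 < L"
            and pq: "\<And>j. 0 < j \<Longrightarrow> j < L \<Longrightarrow> q \<noteq> p j \<and> (R q (p j) \<longleftrightarrow> j = k \<or> j = Suc k)" for p k
        proof -
          have c: "j = 0 \<or> j = L \<or> 0 < j \<and> j < L" if "j \<le> L" for j using that by linarith
          have 1: "q \<noteq> p j" if "j \<le> L" for j using c[OF that] pq p qt qz by blast
          have 2: "R q (p j) \<longleftrightarrow> j = k \<or> j = Suc k" if "j \<le> L" for j
            using c[OF that] pq[of j] p qR0 by auto
          show False using no_roofed_path[OF R Q z p(1-3) L _ p(4,5) 2] 1 by auto
        qed
        let ?r = "\<lambda>i. if i = 0 then ?g 0 else ?g (L - i)"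
        from contract_hole[OF R tz g g0]
        consider "hole R ?g L" | "hole R (?g(0 := z)) L" | "induced_path R (?g(L := z)) L"
          | "induced_path R (?r(L := z)) L" by blast
        then show False
        proof cases
          case 1
          moreover have "?g(0 := t) = ?g" using g0 by auto
          ultimately show False using full[of t] by simp
        next
          case 2
          then show False using full[of z] by simp
        next
          case 3
          show False
          proof (rule opened[OF 3 _ _ in1 in2])
            show "(?g(L := z)) 0 = t" using g0 L by simp
            show "q \<noteq> (?g(L := z)) j \<and> (R q ((?g(L := z)) j) \<longleftrightarrow> j = i' \<or> j = Suc i')" if "0 < j" "j < L" for j
              using qg[of j] qR[OF that] that by simp
          qed simp
        next
          case 4
          show False
          proof (rule opened[OF 4, of "L - 1 - i'"])
            show "(?r(L := z)) 0 = t" using g0 L by simp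
            show "1 \<le> L - 1 - i'" "L - 1 - i' + 1 < L" using in1 in2 by linarith+
            show "q \<noteq> (?r(L := z)) j \<and> (R q ((?r(L := z)) j) \<longleftrightarrow> j = L - 1 - i' \<or> j = Suc (L - 1 - i'))"
              if "0 < j" "j < L" for j
            proof -
              have "(?r(L := z)) j = ?g (L - j)" using that by simp
              moreover have "L - j = i' \<longleftrightarrow> j = Suc (L - 1 - i')" "L - j = Suc i' \<longleftrightarrow> j = L - 1 - i'"
                using that in1 in2 by linarith+
              ultimately show ?thesis using qg[of "L - j"] qR[of "L - j"] that by auto
            qed
          qed simp
        qed
      qed
    qed
  qed
qed

section \<open>Meyniel graphs are quasi-Meyniel\<close>

text \<open>Adjacency in the subgraph induced on \<open>H\<close>.\<close>

definition adj :: "'a set set \<Rightarrow> 'a set \<Rightarrow> 'a \<Rightarrow> 'a \<Rightarrow> bool" where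
  "adj E H u v \<longleftrightarrow> u \<in> H \<and> v \<in> H \<and> {u, v} \<in> E"

lemma adj_sym: "symp (adj E H)"
  unfolding adj_def symp_def by (auto simp: insert_commute)

lemma adj_irrefl: "simple_graph V E \<Longrightarrow> irreflp (adj E H)"
  unfolding adj_def irreflp_def simple_graph_def by auto

lemma edge_endpoints:
  assumes "simple_graph V E" "e \<in> E"
  obtains u v where "e = {u, v}" "u \<noteq> v"
proof -
  have "card e = 2" using assms unfolding simple_graph_def by auto
  then show thesis using that by (auto simp: card_2_iff)
qed

lemma cycle_edges_map:
  "0 < L \<Longrightarrow> cycle_edges (map h [0..<L]) = (\<lambda>i. {h i, h (Suc i mod L)}) ` {..<L}"
  unfolding cycle_edges_def setcompr_eq_image by (intro image_cong) auto

lemma quasi_meyniel_adj: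
  fixes E :: "'a set set"
  assumes sg: "simple_graph V E" and m: "meyniel E"
  shows "quasi_meyniel (adj E H) t"
proof -
  let ?R = "adj E H"
  have mey: "2 \<le> card (chords E vs)" if "is_cycle E vs" "odd (length vs)" "5 \<le> length vs" for vs
    using m that unfolding meyniel_def by blast
  have even_hole: "even L" if h: "hole ?R h L" for h :: "nat \<Rightarrow> 'a" and L
  proof (rule ccontr)
    have L: "4 \<le> L" and inj: "inj_on h {..<L}"
      and adj: "\<And>i j. i < L \<Longrightarrow> j < L \<Longrightarrow> ?R (h i) (h j) \<longleftrightarrow> j = Suc i mod L \<or> i = Suc j mod L"
      using h unfolding hole_def by auto
    assume o: "odd L"
    let ?vs = "map h [0..<L]"
    have ce: "cycle_edges ?vs = (\<lambda>i. {h i, h (Suc i mod L)}) ` {..<L}"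
      using L by (intro cycle_edges_map) simp
    have inE: "{h i, h (Suc i mod L)} \<in> E" if "i < L" for i
      using hole_has_neighbour[OF h that] unfolding adj_def by blast
    have "is_cycle E ?vs"
      unfolding is_cycle_def ce using L inE inj by (auto simp: distinct_map atLeast0LessThan)
    moreover have "chords E ?vs = {}"
    proof -
      have "e \<in> cycle_edges ?vs" if e: "e \<in> E" "e \<subseteq> set ?vs" for e
      proof -
        obtain u v where uv: "e = {u, v}" "u \<noteq> v" using edge_endpoints[OF sg e(1)] .
        obtain i j where ij: "i < L" "j < L" "u = h i" "v = h j" using e(2) uv by auto
        have "h i \<in> H" "h j \<in> H" using hole_has_neighbour[OF h] ij unfolding adj_def by auto
        then have "?R (h i) (h j)" using e(1) uv ij unfolding adj_def by simp
        then have "j = Suc i mod L \<or> i = Suc j mod L" using adj ij by blast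
        then show ?thesis unfolding ce uv ij using ij(1,2) by (auto simp: insert_commute)
      qed
      then show ?thesis unfolding chords_def by auto
    qed
    moreover have "5 \<le> L" using L o by (cases "L = 4") auto
    ultimately show False using mey[of ?vs] o by simp
  qed
  have no_house: False if h: "hole ?R h L" and i: "i < L" and q: "q \<notin> h ` {..<L}"
    and qn: "\<And>j. j < L \<Longrightarrow> ?R q (h j) \<longleftrightarrow> j = i \<or> j = Suc i mod L"
    for h :: "nat \<Rightarrow> 'a" and L q i
  proof -
    \<comment> \<open>After the rotation \<open>q\<close> sees the first and the last vertex, so the hole followed by \<open>q\<close> is an odd
      cycle whose only chord joins these two.\<close>
    define g where "g = (\<lambda>j. h ((j + Suc i) mod L))"
    have g: "hole ?R g L" unfolding g_def by (rule hole_rotate[OF h])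
    have L: "4 \<le> L" and inj: "inj_on g {..<L}"
      and adj: "\<And>i j. i < L \<Longrightarrow> j < L \<Longrightarrow> ?R (g i) (g j) \<longleftrightarrow> j = Suc i mod L \<or> i = Suc j mod L"
      using g unfolding hole_def by auto
    have qg: "q \<noteq> g j" for j using q L unfolding g_def by auto
    have qends: "{q, g 0} \<in> E" "{q, g (L - 1)} \<in> E" "q \<in> H"
    proof -
      have "(L - 1 + Suc i) mod L = i" using L i by simp
      then have "?R q (g 0)" "?R q (g (L - 1))" using qn[of "Suc i mod L"] qn[OF i] L unfolding g_def by auto
      then show "{q, g 0} \<in> E" "{q, g (L - 1)} \<in> E" "q \<in> H" unfolding adj_def by auto
    qed
    have qn': "j = 0 \<or> j = L - 1" if "j < L" "?R q (g j)" for j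
    proof -
      have "(j + Suc i) mod L = (0 + Suc i) mod L \<or> (j + Suc i) mod L = (L - 1 + Suc i) mod L"
        using qn[of "(j + Suc i) mod L"] that i L unfolding g_def by auto
      then have "g j = g 0 \<or> g j = g (L - 1)" unfolding g_def by metis
      then show ?thesis using inj_on_eq_iff[OF inj, of j 0] inj_on_eq_iff[OF inj, of j "L - 1"] that L by auto
    qed
    let ?c = "g(L := q)"
    let ?vs = "map ?c [0..<Suc L]"
    have ce: "cycle_edges ?vs = (\<lambda>i. {?c i, ?c (Suc i mod Suc L)}) ` {..<Suc L}"
      by (rule cycle_edges_map) simp
    have ce_in: "{?c k, ?c (Suc k mod Suc L)} \<in> cycle_edges ?vs" if "k < Suc L" for k
      unfolding ce using that by blast
    have gH: "g j \<in> H" if "j < L" for j using hole_has_neighbour[OF g that] unfolding adj_def by blast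
    have e1: "{g k, g (Suc k)} \<in> cycle_edges ?vs" if "Suc k < L" for k
      using ce_in[of k] that by (simp del: upt_Suc)
    have e2: "{q, g 0} \<in> cycle_edges ?vs" "{q, g (L - 1)} \<in> cycle_edges ?vs"
    proof -
      have "L - 1 < Suc L" "?c (L - 1) = g (L - 1)" "?c (Suc (L - 1) mod Suc L) = q" using L by auto
      then show "{q, g 0} \<in> cycle_edges ?vs" "{q, g (L - 1)} \<in> cycle_edges ?vs"
        using ce_in[of L] ce_in[of "L - 1"] L by (simp_all add: insert_commute del: upt_Suc)
    qed
    have dist: "inj_on ?c {..<Suc L}"
      using inj qg by (auto simp: inj_on_def less_Suc_eq)
    have "e \<in> E" if ee: "e \<in> cycle_edges ?vs" for e
    proof -
      obtain k where k: "k < Suc L" "e = {?c k, ?c (Suc k mod Suc L)}" using ee unfolding ce by auto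
      consider "Suc k < L" | "k = L - 1" | "k = L" using k(1) by linarith
      then show ?thesis
      proof cases
        case 1
        then have "?R (g k) (g (Suc k))" using adj[of k "Suc k"] by simp
        then show ?thesis using k 1 unfolding adj_def by simp
      qed (use k qends L in \<open>auto simp: insert_commute\<close>)
    qed
    then have "is_cycle E ?vs"
      unfolding is_cycle_def using L dist by (auto simp: distinct_map atLeast0LessThan simp del: upt_Suc)
    moreover have "odd (length ?vs)" "5 \<le> length ?vs" using even_hole[OF g] L by simp_all
    ultimately have two: "2 \<le> card (chords E ?vs)" by (rule mey)
    have "chords E ?vs \<subseteq> {{g 0, g (L - 1)}}"
    proof
      fix e assume "e \<in> chords E ?vs"
      then have e: "e \<in> E" "e \<subseteq> set ?vs" "e \<notin> cycle_edges ?vs" unfolding chords_def by auto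
      obtain u v where uv: "e = {u, v}" "u \<noteq> v" using edge_endpoints[OF sg e(1)] .
      have set: "set ?vs = insert q (g ` {..<L})"
        by (auto simp: less_Suc_eq image_iff atLeast0LessThan simp del: upt_Suc)
      have inner: "{a, b} = {g 0, g (L - 1)}" if ab: "{a, b} \<in> E" "{a, b} \<notin> cycle_edges ?vs"
        "a \<in> g ` {..<L}" "b \<in> g ` {..<L}" for a b
      proof -
        obtain i j where ij: "i < L" "j < L" "a = g i" "b = g j" using ab by auto
        then have "?R (g i) (g j)" using ab(1) gH unfolding adj_def by blast
        then have "j = Suc i mod L \<or> i = Suc j mod L" using adj ij by blast
        moreover have "Suc i mod L \<noteq> j \<or> Suc i = L" using e1[of i] ab(2) ij by (cases "Suc i < L") auto
        moreover have "Suc j mod L \<noteq> i \<or> Suc j = L" using e1[of j] ab(2) ij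
          by (cases "Suc j < L") (auto simp: insert_commute)
        ultimately have "i = L - 1 \<and> j = 0 \<or> j = L - 1 \<and> i = 0" using ij by auto
        then show ?thesis using ij by (auto simp: insert_commute)
      qed
      have qc: "{q, b} \<in> cycle_edges ?vs" if ab: "{q, b} \<in> E" "b \<in> g ` {..<L}" for b
      proof -
        obtain j where j: "j < L" "b = g j" using ab by auto
        then have "?R q (g j)" using ab(1) gH qends(3) unfolding adj_def by blast
        then show ?thesis using qn'[OF j(1)] e2 j(2) by auto
      qed
      show "e \<in> {{g 0, g (L - 1)}}"
        using e uv set inner[of u v] qc[of u] qc[of v] by (auto simp: insert_commute)
    qed
    then have "card (chords E ?vs) \<le> 1" using card_mono[of "{{g 0, g (L - 1)}}"] by fastforce
    then show False using two by simp
  qed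
  show ?thesis unfolding quasi_meyniel_def using even_hole no_house by blast
qed

section \<open>Contracting a stable set\<close>

text \<open>The stable set \<open>T\<close> contracted to its member \<open>t\<close>; the other members of \<open>T\<close> become isolated.\<close>

definition collapse :: "('a \<Rightarrow> 'a \<Rightarrow> bool) \<Rightarrow> 'a set \<Rightarrow> 'a \<Rightarrow> 'a \<Rightarrow> 'a \<Rightarrow> bool" where
  "collapse R T t u v \<longleftrightarrow>
     (if u \<in> T then u = t \<and> v \<notin> T \<and> (\<exists>w\<in>T. R w v)
      else if v \<in> T then v = t \<and> (\<exists>w\<in>T. R u w) else R u v)"

lemma collapse_sym: "symp R \<Longrightarrow> symp (collapse R T t)"
  unfolding collapse_def symp_def by meson

lemma collapse_irrefl: "irreflp R \<Longrightarrow> irreflp (collapse R T t)"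
  unfolding collapse_def irreflp_def by simp

lemma collapse_singleton: "symp R \<Longrightarrow> irreflp R \<Longrightarrow> collapse R {t} t = R"
  unfolding collapse_def symp_def irreflp_def by (intro ext) auto

lemma contract_collapse:
  assumes "symp R" "t \<in> T" "z \<notin> T" "\<And>w. w \<in> T \<Longrightarrow> \<not> R w z" "\<not> R z z"
  shows "contract (collapse R T t) t z = collapse R (insert z T) t"
proof (intro ext)
  fix u v
  have "R a b \<Longrightarrow> R b a" for a b using assms(1) by (meson sympD)
  then show "contract (collapse R T t) t z u v = collapse R (insert z T) t u v"
    using assms(2-) unfolding contract_def collapse_def by auto
qed

lemma collapse_best_partner:
  assumes fin: "finite H" and RH: "\<And>u v. R u v \<Longrightarrow> u \<in> H \<and> v \<in> H" and sy: "symp R"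
    and T: "t \<in> T" "T \<subseteq> H" and z0: "z0 \<in> H - T" "\<And>w. w \<in> T \<Longrightarrow> \<not> R w z0"
  obtains z where "z \<in> H - T" "\<And>w. w \<in> T \<Longrightarrow> \<not> R w z" "best_partner (collapse R T t) t z"
proof -
  let ?C = "collapse R T t"
  let ?Z = "{z \<in> H - T. \<forall>w\<in>T. \<not> R w z}"
  let ?f = "\<lambda>z. card {x. ?C t x \<and> ?C z x}"
  have CH: "?C u v \<Longrightarrow> u \<in> H \<and> v \<in> H" for u v using T RH unfolding collapse_def by (auto split: if_splits)
  have finN: "finite {x. ?C t x \<and> ?C u x}" for u by (rule finite_subset[OF _ fin]) (use CH in auto)
  have "finite (?f ` ?Z)" "?f ` ?Z \<noteq> {}" using fin z0 by auto
  then have "Max (?f ` ?Z) \<in> ?f ` ?Z" by (rule Max_in)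
  then obtain z where z: "z \<in> ?Z" "?f z = Max (?f ` ?Z)" by auto
  have mx: "?f u \<le> ?f z" if "u \<in> ?Z" for u
    unfolding z(2) by (rule Max_ge) (use fin that in auto)
  have "best_partner ?C t z"
    unfolding best_partner_def
  proof (intro conjI allI impI)
    show "z \<noteq> t" "\<not> ?C t z" using z T unfolding collapse_def by auto
  next
    fix u assume u: "u \<noteq> t \<and> \<not> ?C t u"
    show "\<not> {x. ?C t x \<and> ?C z x} \<subset> {x. ?C t x \<and> ?C u x}"
    proof (cases "u \<in> H - T")
      case True
      have "\<not> R w u" if "w \<in> T" for w using u T True that unfolding collapse_def by auto
      then have "u \<in> ?Z" using True by simp
      then show ?thesis using mx psubset_card_mono[OF finN] by (meson leD)
    next
      case False
      have "u = t" if "?C u x" for x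
      proof -
        have "u \<in> T" using CH[OF that] False by blast
        then show ?thesis using that unfolding collapse_def by simp
      qed
      then have "{x. ?C t x \<and> ?C u x} = {}" using u by blast
      then show ?thesis by blast
    qed
  qed
  then show thesis using that[of z] z(1) by simp
qed

lemma shortest_path:
  assumes C: "symp C" "irreflp C" and S: "S = {(u, v). u \<in> X \<and> v \<in> X \<and> C u v}"
    and tz: "(t, z) \<in> S\<^sup>*" "t \<in> X"
  obtains p k where "induced_path C p k" "p 0 = t" "p k = z" "\<And>i. i \<le> k \<Longrightarrow> p i \<in> X"
proof -
  obtain n where n: "(t, z) \<in> S ^^ n" using rtrancl_imp_relpow[OF tz(1)] by blast
  define k where "k = (LEAST n. (t, z) \<in> S ^^ n)"
  have k: "(t, z) \<in> S ^^ k" unfolding k_def by (rule LeastI[of _ n]) (rule n)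
  have least: "k \<le> m" if "(t, z) \<in> S ^^ m" for m unfolding k_def by (rule Least_le) (rule that)
  obtain p where p: "p 0 = t" "p k = z" "\<And>i. i < k \<Longrightarrow> (p i, p (Suc i)) \<in> S"
    using k unfolding relpow_fun_conv by blast
  have X: "p i \<in> X" if "i \<le> k" for i
    using p(3)[of "i - 1"] that tz(2) p(1) unfolding S by (cases i) auto
  have head_walk: "(t, p i) \<in> S ^^ i" if "i \<le> k" for i
    unfolding relpow_fun_conv using p that by (intro exI[of _ p]) auto
  have tail_walk: "(p i, z) \<in> S ^^ (k - i)" if "i \<le> k" for i
    unfolding relpow_fun_conv using p that by (intro exI[of _ "\<lambda>j. p (i + j)"]) auto
  have ne: "p i \<noteq> p j" if "i < j" "j \<le> k" for i j
  proof
    assume "p i = p j"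
    then have "(t, z) \<in> S ^^ (i + (k - j))"
      using head_walk[of i] tail_walk[of j] that unfolding relpow_add by auto
    then show False using least that by fastforce
  qed
  have na: "\<not> C (p i) (p j)" if "Suc i < j" "j \<le> k" for i j
  proof
    assume "C (p i) (p j)"
    then have "(p i, p j) \<in> S" using X that unfolding S by auto
    then have "(t, p j) \<in> S ^^ (Suc i)" using head_walk[of i] that by auto
    then have "(t, z) \<in> S ^^ (Suc i + (k - j))"
      using tail_walk[of j] that unfolding relpow_add by auto
    then have "k \<le> Suc i + (k - j)" by (rule least)
    then show False using that by linarith
  qed
  have ad: "C (p i) (p (Suc i))" if "i < k" for i using p(3)[OF that] unfolding S by auto
  have sy: "C u v \<Longrightarrow> C v u" for u v using C(1) by (meson sympD)
  have irr: "\<not> C u u" for u using C(2) by (meson irreflpD)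
  have "induced_path C p k"
  proof (rule induced_pathI)
    fix x y assume "x \<le> k" "y \<le> k" "p x = p y"
    then show "x = y" using ne[of x y] ne[of y x] by (metis linorder_neqE_nat)
  next
    fix x y assume xy: "x \<le> k" "y \<le> k"
    consider "x = y" | "y = Suc x" | "x = Suc y" | "Suc x < y" | "Suc y < x" by linarith
    then show "C (p x) (p y) \<longleftrightarrow> y = Suc x \<or> x = Suc y"
    proof cases
      case 1 then show ?thesis using irr by simp
    next
      case 2 then show ?thesis using ad[of x] xy by simp
    next
      case 3 then show ?thesis using sy[OF ad[of y]] xy by simp
    next
      case 4 then show ?thesis using na[OF 4] xy by simp
    next
      case 5 then show ?thesis using na[OF 5] sy[of "p x" "p y"] xy by auto
    qed
  qed
  then show thesis using that p X by blast
qed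

section \<open>Kempe changes\<close>

definition stable :: "('a \<Rightarrow> 'a \<Rightarrow> bool) \<Rightarrow> 'a set \<Rightarrow> bool" where
  "stable R A \<longleftrightarrow> (\<forall>x\<in>A. \<forall>y\<in>A. \<not> R x y)"

text \<open>The set \<open>K\<close> is the component of \<open>z\<close> in the contracted graph induced on the symmetric difference of
  \<open>A\<close> and \<open>B\<close>, where \<open>t\<close> takes the place of all of \<open>T\<close>. This graph is bipartite with \<open>t\<close> and \<open>z\<close> on different
  sides.\<close>

lemma kempe_merge:
  assumes R: "symp R" "irreflp R" and A: "stable R A" and B: "stable R B"
    and T: "t \<in> T" "T \<subseteq> A" and z: "z \<in> B" "z \<notin> A"
    and even_pair: "\<And>p k. induced_path (collapse R T t) p k \<Longrightarrow> p 0 = t \<Longrightarrow> p k = z \<Longrightarrow> even k"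
  obtains K where "K \<subseteq> (A - B) \<union> (B - A)" "stable R (A - K \<union> (K - A))" "stable R (B - K \<union> (K - B))"
    "insert z T \<subseteq> A - K \<union> (K - A)"
proof -
  let ?C = "collapse R T t"
  define X where "X = insert t (A - B - T) \<union> (B - A)"
  define S where "S = {(u, v). u \<in> X \<and> v \<in> X \<and> ?C u v}"
  define K where "K = {v. (z, v) \<in> S\<^sup>*}"
  have sy: "R u v \<Longrightarrow> R v u" for u v using R(1) by (meson sympD)
  have CS: "symp ?C" "irreflp ?C" using R by (simp_all add: collapse_sym collapse_irrefl)
  have csy: "?C u v \<Longrightarrow> ?C v u" for u v using CS(1) by (meson sympD)
  have zX: "z \<in> X" using z unfolding X_def by auto
  have KX: "K \<subseteq> X"
  proof
    fix v assume "v \<in> K"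
    then have "(z, v) \<in> S\<^sup>*" unfolding K_def by simp
    then show "v \<in> X" by (induction rule: rtrancl_induct) (use zX in \<open>auto simp: S_def\<close>)
  qed
  have closed: "v \<in> K" if "u \<in> K" "v \<in> X" "?C u v" for u v
    using that KX unfolding K_def S_def by (auto intro: rtrancl_into_rtrancl)
  have bip: "(u \<in> B - A) \<noteq> (v \<in> B - A)" if "u \<in> X" "v \<in> X" "?C u v" for u v
  proof
    assume eq: "(u \<in> B - A) = (v \<in> B - A)"
    show False
    proof (cases "u \<in> B - A")
      case True
      then have "R u v" using that(3) eq T unfolding collapse_def by (auto split: if_splits)
      then show False using True eq B unfolding stable_def by blast
    next
      case False
      then have uv: "u \<in> A" "v \<in> A" using that eq T unfolding X_def by auto
      have "\<exists>a\<in>A. \<exists>b\<in>A. R a b" using that(3) uv T unfolding collapse_def by (auto split: if_splits)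
      then show False using A unfolding stable_def by blast
    qed
  qed
  have tK: "t \<notin> K"
  proof
    assume "t \<in> K"
    moreover have "sym (S\<^sup>*)" by (rule sym_rtrancl) (use csy in \<open>auto simp: S_def sym_def\<close>)
    ultimately have "(t, z) \<in> S\<^sup>*" unfolding K_def by (auto dest: symD)
    moreover have "t \<in> X" unfolding X_def by simp
    ultimately obtain p k where p: "induced_path ?C p k" "p 0 = t" "p k = z" "\<And>i. i \<le> k \<Longrightarrow> p i \<in> X"
      using shortest_path[OF CS S_def] by blast
    have "p i \<in> B - A \<longleftrightarrow> odd i" if "i \<le> k" for i using that
    proof (induction i)
      case 0
      then show ?case using p(2) T by auto
    next
      case (Suc i)
      have "?C (p i) (p (Suc i))" using p(1) Suc.prems unfolding induced_path_def by auto
      then show ?case using Suc bip[of "p i" "p (Suc i)"] p(4)[of i] p(4)[of "Suc i"] by auto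
    qed
    then have "odd k" using p(3) z by auto
    then show False using even_pair[OF p(1-3)] by simp
  qed
  have KT: "K \<inter> T = {}" using KX tK T unfolding X_def by auto
  have zK: "z \<in> K" unfolding K_def by simp
  have K1: "K \<subseteq> (A - B) \<union> (B - A)" using KX tK unfolding X_def by auto
  have out: "\<not> R u v" if "u \<in> (A - B) \<union> (B - A)" "u \<notin> K" "v \<in> K" for u v
  proof
    assume r: "R u v"
    \<comment> \<open>A member of \<open>T\<close> other than \<open>t\<close> is represented by \<open>t\<close>, which lies outside \<open>K\<close>.\<close>
    show False
    proof (cases "u \<in> T")
      case True
      then have "?C t v" using r that(3) KT T unfolding collapse_def by auto
      then show False using closed[OF that(3), of t] csy tK unfolding X_def by blast
    next
      case False
      then have "u \<in> X" using that(1) unfolding X_def by auto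
      moreover have "?C v u" using r False that(3) KT sy unfolding collapse_def by auto
      ultimately show False using closed that by blast
    qed
  qed
  have st: "stable R (P - K \<union> (K - P))"
    if PQ: "P = A \<and> Q = B \<or> P = B \<and> Q = A" for P Q
  proof -
    have PS: "stable R P" "stable R Q" using PQ A B by auto
    have KP: "K \<subseteq> (P - Q) \<union> (Q - P)" using PQ K1 by blast
    have outP: "\<not> R u v" if "u \<in> P - K" "v \<in> K - P" for u v
    proof (cases "u \<in> Q")
      case True
      then show ?thesis using PS(2) that KP unfolding stable_def by blast
    next
      case False
      then show ?thesis using out[of u v] that PQ by blast
    qed
    have "\<not> R u v" if "u \<in> K - P" "v \<in> K - P" for u v
      using that KP PS(2) unfolding stable_def by blast
    then show ?thesis using outP PS(1) sy unfolding stable_def by blast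
  qed
  show thesis
  proof (rule that[OF K1 st[of A B] st[of B A]])
    show "insert z T \<subseteq> A - K \<union> (K - A)" using zK z KT T by auto
  qed auto
qed

lemma stable_sets_adj:
  assumes "simple_graph V E" "H \<subseteq> V" "A \<subseteq> H"
  shows "A \<in> stable_sets V E \<longleftrightarrow> stable (adj E H) A"
proof -
  have "{i} \<notin> E" for i using assms(1) unfolding simple_graph_def by auto
  then have "{i, j} \<in> E \<Longrightarrow> i \<noteq> j" for i j by auto
  then show ?thesis using assms(2,3) unfolding stable_sets_def stable_def adj_def by blast
qed

text \<open>An exchange of two members of a multiset of sets from \<open>\<S>\<close> for two sets with the same total. This
  includes trivial exchanges.\<close>

definition move :: "'a set set \<Rightarrow> 'a set multiset \<Rightarrow> 'a set multiset \<Rightarrow> bool" where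
  "move \<S> M N \<longleftrightarrow> (\<exists>A B A' B' P. {A, B, A', B'} \<subseteq> \<S> \<and>
     mset_set A + mset_set B = mset_set A' + mset_set B' \<and>
     M = {#A, B#} + P \<and> N = {#A', B'#} + P)"

text \<open>How often each vertex is covered.\<close>

definition weight :: "'a set multiset \<Rightarrow> 'a multiset" where
  "weight M = (\<Sum>A\<in>#M. mset_set A)"

lemma weight_simps [simp]:
  "weight {#} = {#}" "weight (add_mset A M) = mset_set A + weight M" "weight (M + N) = weight M + weight N"
  unfolding weight_def by simp_all

lemma set_mset_weight:
  assumes "\<And>A. A \<in># M \<Longrightarrow> finite A"
  shows "set_mset (weight M) = \<Union>(set_mset M)"
  using assms by (induction M) auto

lemma move_sym: "move \<S> M N \<Longrightarrow> move \<S> N M"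
proof -
  assume "move \<S> M N"
  then obtain A B A' B' P where "{A, B, A', B'} \<subseteq> \<S>"
    "mset_set A + mset_set B = mset_set A' + mset_set B'" "M = {#A, B#} + P" "N = {#A', B'#} + P"
    unfolding move_def by blast
  then show "move \<S> N M"
    unfolding move_def by (intro exI[of _ A'] exI[of _ B'] exI[of _ A] exI[of _ B] exI[of _ P]) auto
qed

lemma move_invariants:
  assumes "move \<S> M N" "set_mset M \<subseteq> \<S>"
  shows "set_mset N \<subseteq> \<S>" "size N = size M" "weight N = weight M"
proof -
  obtain A B A' B' P where m: "{A, B, A', B'} \<subseteq> \<S>"
    "mset_set A + mset_set B = mset_set A' + mset_set B'" "M = {#A, B#} + P" "N = {#A', B'#} + P"
    using assms(1) unfolding move_def by blast
  show "set_mset N \<subseteq> \<S>" "size N = size M" using m assms(2) by auto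
  have "weight M = mset_set A + mset_set B + weight P" "weight N = mset_set A' + mset_set B' + weight P"
    unfolding m(3,4) by (simp_all add: ac_simps)
  then show "weight N = weight M" using m(2) by simp
qed

lemma moves_invariants:
  assumes "(move \<S>)\<^sup>*\<^sup>* M N" "set_mset M \<subseteq> \<S>"
  shows "set_mset N \<subseteq> \<S> \<and> size N = size M \<and> weight N = weight M"
  using assms
proof (induction rule: rtranclp_induct)
  case (step N N')
  then show ?case using move_invariants[OF step.hyps(2)] by simp
qed simp

lemma moves_sym: "(move \<S>)\<^sup>*\<^sup>* M N \<Longrightarrow> (move \<S>)\<^sup>*\<^sup>* N M"
  by (rule sympD[OF symp_rtranclp]) (auto intro: sympI move_sym)

lemma move_add_mset: "move \<S> M N \<Longrightarrow> move \<S> (add_mset A M) (add_mset A N)"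
  unfolding move_def by (elim exE conjE) (metis union_mset_add_mset_right)

lemma moves_add_mset: "(move \<S>)\<^sup>*\<^sup>* M N \<Longrightarrow> (move \<S>)\<^sup>*\<^sup>* (add_mset A M) (add_mset A N)"
  by (induction rule: rtranclp_induct) (auto intro: move_add_mset rtranclp.rtrancl_into_rtrancl)

lemma mset_set_swap:
  assumes "finite A" "finite B" "K \<subseteq> (A - B) \<union> (B - A)"
  shows "mset_set A + mset_set B = mset_set (A - K \<union> (K - A)) + mset_set (B - K \<union> (K - B))"
proof (rule multiset_eqI)
  fix x
  have "finite K" using assms finite_subset by blast
  then have "finite (A - K \<union> (K - A))" "finite (B - K \<union> (K - B))" using assms(1,2) by simp_all
  then show "count (mset_set A + mset_set B) x =
      count (mset_set (A - K \<union> (K - A)) + mset_set (B - K \<union> (K - B))) x"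
    using assms subsetD[OF assms(3), of x]
    by (cases "x \<in> A"; cases "x \<in> B"; cases "x \<in> K") (simp_all add: count_mset_set')
qed

section \<open>Connectedness of the fibres\<close>

text \<open>Every multiset of stable sets with union \<open>H\<close> can be moved to one with a member that includes the
  stable set \<open>T\<close>. Quasi-Meynielity of the graph with \<open>T\<close> contracted to \<open>t\<close> is the induction
  invariant that allows \<open>T\<close> to be extended.\<close>

definition absorbable :: "'a set \<Rightarrow> 'a set set \<Rightarrow> 'a set \<Rightarrow> 'a \<Rightarrow> 'a set \<Rightarrow> bool" where
  "absorbable V E H t T \<longleftrightarrow> t \<in> T \<and> T \<subseteq> H \<and> stable (adj E H) T \<and>
     quasi_meyniel (collapse (adj E H) T t) t \<and>
     (\<forall>M. set_mset M \<subseteq> stable_sets V E \<and> \<Union>(set_mset M) = H \<longrightarrow>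
        (\<exists>N. (move (stable_sets V E))\<^sup>*\<^sup>* M N \<and> (\<exists>A\<in>#N. T \<subseteq> A)))"

lemma absorbable_singleton:
  assumes sg: "simple_graph V E" and m: "meyniel E" and t: "t \<in> H"
  shows "absorbable V E H t {t}"
  unfolding absorbable_def
proof (intro conjI allI impI)
  show "stable (adj E H) {t}" using adj_irrefl[OF sg, of H] unfolding stable_def irreflp_def by auto
  show "quasi_meyniel (collapse (adj E H) {t} t) t"
    using quasi_meyniel_adj[OF sg m] collapse_singleton[OF adj_sym adj_irrefl[OF sg]] by metis
  fix M assume "set_mset M \<subseteq> stable_sets V E \<and> \<Union>(set_mset M) = H"
  then have "\<exists>A\<in>#M. {t} \<subseteq> A" using t by blast
  then show "\<exists>N. (move (stable_sets V E))\<^sup>*\<^sup>* M N \<and> (\<exists>A\<in>#N. {t} \<subseteq> A)" by blast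
qed (use t in auto)

lemma absorbable_extend:
  assumes sg: "simple_graph V E" and HV: "H \<subseteq> V" and J: "absorbable V E H t T"
    and z0: "z0 \<in> H - T" "\<And>w. w \<in> T \<Longrightarrow> \<not> adj E H w z0"
  obtains z where "z \<in> H - T" "absorbable V E H t (insert z T)"
proof -
  let ?R = "adj E H" and ?S = "stable_sets V E"
  have finV: "finite V" using sg unfolding simple_graph_def by simp
  have finH: "finite H" using finite_subset[OF HV finV] .
  have R: "symp ?R" "irreflp ?R" using adj_sym adj_irrefl[OF sg] by auto
  have sy: "?R u v \<Longrightarrow> ?R v u" for u v using R(1) by (meson sympD)
  have irr: "\<not> ?R u u" for u using R(2) by (meson irreflpD)
  have T: "t \<in> T" "T \<subseteq> H" "stable ?R T" and Q: "quasi_meyniel (collapse ?R T t) t"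
    and merge: "\<And>M. set_mset M \<subseteq> ?S \<Longrightarrow> \<Union>(set_mset M) = H \<Longrightarrow> \<exists>N. (move ?S)\<^sup>*\<^sup>* M N \<and> (\<exists>A\<in>#N. T \<subseteq> A)"
    using J unfolding absorbable_def by auto
  have C: "symp (collapse ?R T t)" "irreflp (collapse ?R T t)"
    using R by (simp_all add: collapse_sym collapse_irrefl)
  obtain z where z: "z \<in> H - T" "\<And>w. w \<in> T \<Longrightarrow> \<not> ?R w z" "best_partner (collapse ?R T t) t z"
    using collapse_best_partner[of H ?R t T z0, OF finH _ R(1) T(1,2) z0] unfolding adj_def by blast
  have fin: "finite A" if "A \<in> ?S" for A
    using that finite_subset[OF _ finV] unfolding stable_sets_def by blast
  have "\<exists>N. (move ?S)\<^sup>*\<^sup>* M N \<and> (\<exists>A\<in>#N. insert z T \<subseteq> A)"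
    if M: "set_mset M \<subseteq> ?S" "\<Union>(set_mset M) = H" for M
  proof -
    obtain N A where N: "(move ?S)\<^sup>*\<^sup>* M N" "A \<in># N" "T \<subseteq> A" using merge[OF M] by blast
    have inv: "set_mset N \<subseteq> ?S" "weight N = weight M" using moves_invariants[OF N(1) M(1)] by auto
    have UN: "\<Union>(set_mset N) = H"
      using set_mset_weight[of M] set_mset_weight[of N] inv M fin by (metis subsetD)
    show ?thesis
    proof (cases "z \<in> A")
      case True
      then show ?thesis using N by blast
    next
      case False
      obtain B where B: "B \<in># N" "z \<in> B" using UN z(1) by blast
      have AB: "A \<noteq> B" "A \<subseteq> H" "B \<subseteq> H" "A \<in> ?S" "B \<in> ?S" using False B N(2) UN inv(1) by auto
      have st: "stable ?R A" "stable ?R B" using stable_sets_adj[OF sg HV] AB by auto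
      obtain K where K: "K \<subseteq> (A - B) \<union> (B - A)" "stable ?R (A - K \<union> (K - A))"
        "stable ?R (B - K \<union> (K - B))" "insert z T \<subseteq> A - K \<union> (K - A)"
        using kempe_merge[OF R st T(1) N(3) B(2) False] best_partner_even_pair[OF C Q z(3)] by blast
      let ?A = "A - K \<union> (K - A)" and ?B = "B - K \<union> (K - B)"
      have "?A \<subseteq> H" "?B \<subseteq> H" using K(1) AB by auto
      then have S: "?A \<in> ?S" "?B \<in> ?S" using K(2,3) stable_sets_adj[OF sg HV] by auto
      have "B \<in># N - {#A#}" using B(1) AB(1) by (simp add: in_diff_count)
      then obtain P where P: "N = {#A, B#} + P"
        using N(2) by (metis add_mset_add_single insert_DiffM union_mset_add_mset_left union_mset_add_mset_right add.commute)
      have "move ?S N ({#?A, ?B#} + P)"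
        unfolding move_def using S AB P mset_set_swap[OF fin fin K(1)] by blast
      then have "(move ?S)\<^sup>*\<^sup>* M ({#?A, ?B#} + P)" using N(1) by simp
      moreover have "?A \<in># {#?A, ?B#} + P" by simp
      ultimately show ?thesis using K(4) by blast
    qed
  qed
  moreover have "stable ?R (insert z T)" using T(3) z(2) sy irr unfolding stable_def by blast
  moreover have "quasi_meyniel (collapse ?R (insert z T) t) t"
    using quasi_meyniel_contract[OF C Q z(3)] contract_collapse[of ?R t T z] R(1) T(1) z(1,2) irr by simp
  ultimately have "absorbable V E H t (insert z T)"
    unfolding absorbable_def using T z(1) by blast
  then show thesis using that z(1) by blast
qed

text \<open>Every vertex of \<open>H\<close> outside an absorbable set that cannot be extended has a neighbour in it, so a stable subset of \<open>H\<close> that includes it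
  is equal to it.\<close>

lemma common_stable_set:
  assumes sg: "simple_graph V E" and m: "meyniel E" and HV: "H \<subseteq> V" "H \<noteq> {}"
  obtains A where "A \<in> stable_sets V E"
    "\<And>M. set_mset M \<subseteq> stable_sets V E \<Longrightarrow> \<Union>(set_mset M) = H \<Longrightarrow>
       \<exists>N. (move (stable_sets V E))\<^sup>*\<^sup>* M N \<and> A \<in># N"
proof -
  let ?R = "adj E H" and ?S = "stable_sets V E"
  have finV: "finite V" using sg unfolding simple_graph_def by simp
  have finH: "finite H" using finite_subset[OF HV(1) finV] .
  obtain t where t: "t \<in> H" using HV by auto
  have "\<exists>A. absorbable V E H t A \<and> (\<forall>z\<in>H - A. \<exists>w\<in>A. ?R w z)" if "absorbable V E H t T" for T
    using that
  proof (induction "card (H - T)" arbitrary: T rule: less_induct)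
    case less
    show ?case
    proof (cases "\<forall>z\<in>H - T. \<exists>w\<in>T. ?R w z")
      case True
      then show ?thesis using less.prems by blast
    next
      case False
      then obtain z0 where "z0 \<in> H - T" "\<And>w. w \<in> T \<Longrightarrow> \<not> ?R w z0" by blast
      then obtain z where z: "z \<in> H - T" "absorbable V E H t (insert z T)"
        using absorbable_extend[OF sg HV(1) less.prems] by blast
      have "card (H - insert z T) < card (H - T)"
        by (rule psubset_card_mono) (use z finH in auto)
      then show ?thesis using less.hyps z(2) by blast
    qed
  qed
  then obtain A where A: "absorbable V E H t A" "\<And>z. z \<in> H - A \<Longrightarrow> \<exists>w\<in>A. ?R w z"
    using absorbable_singleton[OF sg m t] by blast
  have AH: "A \<subseteq> H" "t \<in> A" "stable ?R A" using A(1) unfolding absorbable_def by auto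
  show thesis
  proof (rule that)
    show "A \<in> ?S" using stable_sets_adj[OF sg HV(1)] AH by auto
    fix M assume M: "set_mset M \<subseteq> ?S" "\<Union>(set_mset M) = H"
    then obtain N B where N: "(move ?S)\<^sup>*\<^sup>* M N" "B \<in># N" "A \<subseteq> B"
      using A(1) unfolding absorbable_def by blast
    have fin: "finite A" if "A \<in> ?S" for A
      using that finite_subset[OF _ finV] unfolding stable_sets_def by blast
    have inv: "set_mset N \<subseteq> ?S" "weight N = weight M" using moves_invariants[OF N(1) M(1)] by auto
    have "\<Union>(set_mset N) = H"
      using set_mset_weight[of M] set_mset_weight[of N] inv M fin by (metis subsetD)
    then have "B \<subseteq> H" "B \<in> ?S" using N(2) inv by auto
    then have "stable ?R B" using stable_sets_adj[OF sg HV(1)] by blast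
    then have "B = A" using A(2) N(3) \<open>B \<subseteq> H\<close> unfolding stable_def by blast
    then show "\<exists>N. (move ?S)\<^sup>*\<^sup>* M N \<and> A \<in># N" using N by blast
  qed
qed

lemma fibre_connected:
  assumes sg: "simple_graph V E" and m: "meyniel E"
    and "set_mset M \<subseteq> stable_sets V E" "set_mset N \<subseteq> stable_sets V E"
    and "size M = size N" "weight M = weight N"
  shows "(move (stable_sets V E))\<^sup>*\<^sup>* M N"
  using assms(3-)
proof (induction "size M" arbitrary: M N)
  case 0
  then show ?case by simp
next
  case (Suc k)
  let ?S = "stable_sets V E" and ?H = "\<Union>(set_mset M)"
  have finV: "finite V" using sg unfolding simple_graph_def by simp
  have fin: "finite A" "A \<subseteq> V" if "A \<in> ?S" for A
    using that finite_subset[OF _ finV] unfolding stable_sets_def by blast+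
  have HN: "\<Union>(set_mset N) = ?H"
    using set_mset_weight[of M] set_mset_weight[of N] Suc.prems fin by (metis subsetD)
  show ?case
  proof (cases "?H = {}")
    case True
    then have "M = replicate_mset (size M) {}" "N = replicate_mset (size N) {}"
      using HN by (auto simp flip: set_mset_subset_singletonD intro!: set_mset_subset_singletonD)
    then show ?thesis using Suc.prems by simp
  next
    case False
    have "?H \<subseteq> V" using Suc.prems(1) fin(2) by blast
    then obtain A where A: "A \<in> ?S" "\<And>M. set_mset M \<subseteq> ?S \<Longrightarrow> \<Union>(set_mset M) = ?H \<Longrightarrow>
       \<exists>N. (move ?S)\<^sup>*\<^sup>* M N \<and> A \<in># N"
      using common_stable_set[OF sg m _ False] by metis
    obtain M' where M': "(move ?S)\<^sup>*\<^sup>* M M'" "A \<in># M'" using A(2)[OF Suc.prems(1)] by blast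
    obtain N' where N': "(move ?S)\<^sup>*\<^sup>* N N'" "A \<in># N'" using A(2)[OF Suc.prems(2) HN] by blast
    obtain P where P: "M' = add_mset A P" using M'(2) by (metis insert_DiffM)
    obtain Q where Q: "N' = add_mset A Q" using N'(2) by (metis insert_DiffM)
    have 1: "set_mset M' \<subseteq> ?S" "size M' = size M" "weight M' = weight M"
      using moves_invariants[OF M'(1) Suc.prems(1)] by auto
    have 2: "set_mset N' \<subseteq> ?S" "size N' = size N" "weight N' = weight N"
      using moves_invariants[OF N'(1) Suc.prems(2)] by auto
    have "mset_set A + weight P = mset_set A + weight Q"
      using 1(3) 2(3) P Q Suc.prems(4) by simp
    then have "weight P = weight Q" by simp
    then have "(move ?S)\<^sup>*\<^sup>* P Q"
      by (intro Suc.hyps(1)) (use Suc.prems Suc.hyps(2) 1 2 P Q in auto)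
    then have "(move ?S)\<^sup>*\<^sup>* M' N'" unfolding P Q by (rule moves_add_mset)
    then show ?thesis using M'(1) moves_sym[OF N'(1)] by (meson rtranclp_trans)
  qed
qed

section \<open>The polynomial rings\<close>

lemma mpoly_ring_simps [simp]:
  "f \<otimes>\<^bsub>mpoly_ring X\<^esub> g = f * g" "\<one>\<^bsub>mpoly_ring X\<^esub> = 1" "\<zero>\<^bsub>mpoly_ring X\<^esub> = 0"
  "f \<oplus>\<^bsub>mpoly_ring X\<^esub> g = f + g"
  unfolding mpoly_ring_def by simp_all

lemma in_carrier_mpoly_ring:
  "f \<in> carrier (mpoly_ring X) \<longleftrightarrow> (\<forall>m\<in>Poly_Mapping.keys f. Poly_Mapping.keys m \<subseteq> X)"
  unfolding mpoly_ring_def by simp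

lemma keys_add_exponents:
  fixes a b :: "'v \<Rightarrow>\<^sub>0 nat"
  shows "Poly_Mapping.keys (a + b) = Poly_Mapping.keys a \<union> Poly_Mapping.keys b"
  by (auto simp: in_keys_iff lookup_add)

lemma mpoly_ring_zero_one: "0 \<in> carrier (mpoly_ring X)" "1 \<in> carrier (mpoly_ring X)"
  by (simp_all add: in_carrier_mpoly_ring)

lemma mpoly_ring_closed:
  assumes "f \<in> carrier (mpoly_ring X)" "g \<in> carrier (mpoly_ring X)"
  shows "f + g \<in> carrier (mpoly_ring X)" "f * g \<in> carrier (mpoly_ring X)"
  using assms Poly_Mapping.keys_add[of f g] Poly_Mapping.keys_mult[of f g]
  by (fastforce simp: in_carrier_mpoly_ring keys_add_exponents)+

lemma mpoly_ring_uminus: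
  assumes "f \<in> carrier (mpoly_ring X)"
  shows "- f \<in> carrier (mpoly_ring X)"
  using assms by (auto simp: in_carrier_mpoly_ring in_keys_iff)

lemma cring_mpoly_ring: "cring (mpoly_ring X)"
proof (intro cringI abelian_groupI comm_monoidI)
  fix f :: "('a, 'b) mpoly" assume "f \<in> carrier (mpoly_ring X)"
  then have "- f \<in> carrier (mpoly_ring X)" by (rule mpoly_ring_uminus)
  then show "\<exists>g\<in>carrier (mpoly_ring X). g \<oplus>\<^bsub>mpoly_ring X\<^esub> f = \<zero>\<^bsub>mpoly_ring X\<^esub>"
    by (intro bexI[of _ "- f"]) simp_all
qed (simp_all add: mpoly_ring_closed mpoly_ring_zero_one algebra_simps)

lemma a_inv_mpoly_ring:
  assumes "f \<in> carrier (mpoly_ring X)"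
  shows "\<ominus>\<^bsub>mpoly_ring X\<^esub> f = - f"
proof -
  interpret cring "mpoly_ring X" by (rule cring_mpoly_ring)
  show ?thesis using minus_equality[of "- f" f] assms mpoly_ring_uminus[OF assms] by simp
qed

lemma mpoly_eq_sum_singles:
  "(f :: ('v, 'k::comm_ring_1) mpoly) = (\<Sum>m\<in>Poly_Mapping.keys f. Poly_Mapping.single m (Poly_Mapping.lookup f m))"
  by (rule poly_mapping_eqI) (auto simp: lookup_sum lookup_single when_def in_keys_iff)

section \<open>Substitution\<close>

text \<open>The image of a monomial under the substitution \<open>g\<close>.\<close>

definition mon_image :: "('v \<Rightarrow> ('w, 'k::comm_ring_1) mpoly) \<Rightarrow> ('v \<Rightarrow>\<^sub>0 nat) \<Rightarrow> ('w, 'k) mpoly" where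
  "mon_image g m = (\<Prod>v\<in>Poly_Mapping.keys m. g v ^ Poly_Mapping.lookup m v)"

lemma mon_image_superset:
  assumes "finite F" "Poly_Mapping.keys m \<subseteq> F"
  shows "mon_image g m = (\<Prod>v\<in>F. g v ^ Poly_Mapping.lookup m v)"
  unfolding mon_image_def using assms by (intro prod.mono_neutral_left) (auto simp: in_keys_iff)

lemma mon_image_add: "mon_image g (a + b) = mon_image g a * mon_image g b"
proof -
  let ?F = "Poly_Mapping.keys a \<union> Poly_Mapping.keys b"
  have "mon_image g c = (\<Prod>v\<in>?F. g v ^ Poly_Mapping.lookup c v)" if "c \<in> {a, b, a + b}" for c
    using that by (intro mon_image_superset) (auto simp: keys_add_exponents)
  then show ?thesis by (simp add: lookup_add power_add prod.distrib)
qed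

lemma Const_simps: "Const 0 = 0" "Const (a + b) = Const a + Const b" "Const (a * b) = Const a * Const b"
  unfolding Const_def by (simp_all add: single_add mult_single)

lemma single_eq_Const_mult: "Poly_Mapping.single m c = Const c * Poly_Mapping.single m 1"
  unfolding Const_def by (simp add: mult_single)

lemma subst_hom_superset:
  assumes "finite F" "Poly_Mapping.keys f \<subseteq> F"
  shows "subst_hom g f = (\<Sum>m\<in>F. Const (Poly_Mapping.lookup f m) * mon_image g m)"
  unfolding subst_hom_def mon_image_def using assms
  by (intro sum.mono_neutral_left) (auto simp: in_keys_iff Const_simps)

lemma subst_hom_add: "subst_hom g (f + h) = subst_hom g f + subst_hom g h"
proof -
  let ?F = "Poly_Mapping.keys f \<union> Poly_Mapping.keys h"
  have "subst_hom g p = (\<Sum>m\<in>?F. Const (Poly_Mapping.lookup p m) * mon_image g m)"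
    if "p \<in> {f, h, f + h}" for p
    using that Poly_Mapping.keys_add[of f h] by (intro subst_hom_superset) auto
  then show ?thesis by (simp add: lookup_add Const_simps distrib_right sum.distrib)
qed

lemma subst_hom_zero: "subst_hom g 0 = 0"
  unfolding subst_hom_def by simp

lemma subst_hom_sum: "subst_hom g (\<Sum>i\<in>I. f i) = (\<Sum>i\<in>I. subst_hom g (f i))"
  by (induction I rule: infinite_finite_induct) (simp_all add: subst_hom_zero subst_hom_add)

lemma subst_hom_single: "subst_hom g (Poly_Mapping.single m c) = Const c * mon_image g m"
  using subst_hom_superset[of "{m}" "Poly_Mapping.single m c" g] by simp

lemma subst_hom_mult: "subst_hom g (f * h) = subst_hom g f * subst_hom g h"
proof -
  have "f * h = (\<Sum>a\<in>Poly_Mapping.keys f. \<Sum>b\<in>Poly_Mapping.keys h.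
      Poly_Mapping.single (a + b) (Poly_Mapping.lookup f a * Poly_Mapping.lookup h b))"
    by (subst mpoly_eq_sum_singles[of f], subst mpoly_eq_sum_singles[of h])
      (simp add: sum_product mult_single)
  also have "subst_hom g \<dots> = (\<Sum>a\<in>Poly_Mapping.keys f. \<Sum>b\<in>Poly_Mapping.keys h.
      (Const (Poly_Mapping.lookup f a) * mon_image g a) * (Const (Poly_Mapping.lookup h b) * mon_image g b))"
    by (simp add: subst_hom_sum subst_hom_single mon_image_add Const_simps mult.assoc mult.left_commute)
  also have "\<dots> = subst_hom g f * subst_hom g h"
    unfolding subst_hom_superset[OF finite_keys order_refl] sum_product ..
  finally show ?thesis .
qed

section \<open>Monomials as multisets\<close>

text \<open>The exponent vector of the product of the variables in a multiset.\<close>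

definition mon :: "'v multiset \<Rightarrow> ('v \<Rightarrow>\<^sub>0 nat)" where
  "mon M = (\<Sum>A\<in>#M. Poly_Mapping.single A 1)"

lemma mon_simps [simp]:
  "mon {#} = 0" "mon (add_mset A M) = Poly_Mapping.single A 1 + mon M" "mon (M + N) = mon M + mon N"
  unfolding mon_def by simp_all

lemma lookup_mon: "Poly_Mapping.lookup (mon M) A = count M A"
  by (induction M) (auto simp: lookup_add lookup_single when_def)

lemma keys_mon: "Poly_Mapping.keys (mon M) = set_mset M"
  by (auto simp: in_keys_iff lookup_mon)

lemma exponent_eq_mon:
  obtains M where "m = mon M"
proof -
  let ?M = "\<Sum>A\<in>Poly_Mapping.keys m. replicate_mset (Poly_Mapping.lookup m A) A"
  have "m = mon ?M"
    by (rule poly_mapping_eqI) (auto simp: lookup_mon count_sum in_keys_iff)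
  then show thesis by (rule that)
qed

lemma mon_degree_mon: "mon_degree (mon M) = size M"
  unfolding mon_degree_def keys_mon lookup_mon by (simp add: size_multiset_overloaded_eq)

lemma mon_image_mon: "mon_image g (mon M) = (\<Prod>A\<in>#M. g A)"
proof (induction M)
  case empty
  then show ?case by (simp add: mon_image_def)
next
  case (add A M)
  have "mon_image g (Poly_Mapping.single A 1) = g A" by (simp add: mon_image_def)
  then show ?case using add by (simp add: mon_image_add)
qed

section \<open>The toric map\<close>

text \<open>The exponent vector of the image of a monomial: the multiplicity with which each vertex is covered,
  and the total degree as the exponent of \<open>s\<close>.\<close>

definition fibre_exponent :: "nat \<Rightarrow> nat set multiset \<Rightarrow> (tvar \<Rightarrow>\<^sub>0 nat)" where
  "fibre_exponent n M =
     (\<Sum>j=1..n. Poly_Mapping.single (TVar j) (count (weight M) j)) + Poly_Mapping.single SVar (size M)"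

lemma lookup_fibre_exponent:
  "Poly_Mapping.lookup (fibre_exponent n M) SVar = size M"
  "j \<in> {1..n} \<Longrightarrow> Poly_Mapping.lookup (fibre_exponent n M) (TVar j) = count (weight M) j"
  unfolding fibre_exponent_def by (simp_all add: lookup_add lookup_sum lookup_single when_def)

lemma fibre_exponent_add: "fibre_exponent n (M + N) = fibre_exponent n M + fibre_exponent n N"
  unfolding fibre_exponent_def by (simp add: single_add sum.distrib algebra_simps)

lemma fibre_exponent_inj:
  assumes "fibre_exponent n M = fibre_exponent n N"
    and "set_mset (weight M) \<subseteq> {1..n}" "set_mset (weight N) \<subseteq> {1..n}"
  shows "size M = size N" "weight M = weight N"
proof -
  show "size M = size N" using assms(1) lookup_fibre_exponent(1) by metis
  show "weight M = weight N"
  proof (rule multiset_eqI)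
    fix j
    show "count (weight M) j = count (weight N) j"
    proof (cases "j \<in> {1..n}")
      case True
      then show ?thesis using assms(1) lookup_fibre_exponent(2) by metis
    next
      case False
      then show ?thesis using assms(2,3) by (metis count_eq_zero_iff subsetD)
    qed
  qed
qed

lemma single_power: "Poly_Mapping.single (Poly_Mapping.single v (Suc 0)) 1 ^ k = Poly_Mapping.single (Poly_Mapping.single v k) (1::'k::comm_ring_1)"
  by (induction k) (simp_all add: mult_single single_add[symmetric])

lemma lookup_rho: "finite A \<Longrightarrow> Poly_Mapping.lookup (rho A) j = count (mset_set A) j"
  unfolding rho_def by (simp add: lookup_sum lookup_single when_def count_mset_set')

lemma prod_single: "(\<Prod>i\<in>I. Poly_Mapping.single (a i) (1::'k::comm_ring_1)) = Poly_Mapping.single (\<Sum>i\<in>I. a i) 1"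
  by (induction I rule: infinite_finite_induct) (simp_all add: mult_single)

lemma toric_var:
  assumes "finite A"
  shows "t_power n (rho A) * Var SVar = Poly_Mapping.single (fibre_exponent n {#A#}) (1::'k::comm_ring_1)"
  unfolding t_power_def fibre_exponent_def Var_def
  by (simp add: single_power prod_single mult_single lookup_rho assms)

lemma toric_mon_image:
  assumes "\<And>A. A \<in># M \<Longrightarrow> finite A"
  shows "mon_image (\<lambda>A. t_power n (rho A) * Var SVar) (mon M) = Poly_Mapping.single (fibre_exponent n M) (1::'k::comm_ring_1)"
  unfolding mon_image_mon using assms
proof (induction M)
  case empty
  then show ?case by (simp add: fibre_exponent_def)
next
  case (add A M)
  then show ?case
    using fibre_exponent_add[of n "{#A#}" M] by (simp add: toric_var mult_single)
qed

lemma toric_map_simps: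
  "toric_map n (f + h) = toric_map n f + toric_map n h"
  "toric_map n (f * h) = toric_map n f * toric_map n h" "toric_map n 0 = 0"
  unfolding toric_map_def by (simp_all add: subst_hom_add subst_hom_mult subst_hom_zero)

lemma toric_map_minus: "toric_map n (- f) = - toric_map n f"
proof -
  have "toric_map n (- f) + toric_map n f = toric_map n (- f + f)"
    by (simp only: toric_map_simps(1))
  then have "toric_map n (- f) + toric_map n f = 0" by (simp add: toric_map_simps(3))
  then show ?thesis by (simp add: eq_neg_iff_add_eq_0)
qed

lemma toric_map_single:
  assumes "\<And>A. A \<in># M \<Longrightarrow> finite A"
  shows "toric_map n (Poly_Mapping.single (mon M) c) = Poly_Mapping.single (fibre_exponent n M) c"
  unfolding toric_map_def subst_hom_single
  by (subst toric_mon_image) (use assms in \<open>auto simp: Const_def mult_single\<close>)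

lemma toric_ideal_iff:
  "f \<in> toric_ideal n E \<longleftrightarrow> f \<in> carrier (source_ring n E) \<and> toric_map n f = 0"
  unfolding toric_ideal_def a_kernel_def kernel_def source_ring_def target_ring_def by (simp add: mpoly_ring_def)

lemma ideal_toric_ideal: "ideal (toric_ideal n E) (source_ring n E)"
proof -
  let ?R = "mpoly_ring (stable_sets {1..n} E)"
  interpret cring ?R by (rule cring_mpoly_ring)
  have I: "f \<in> toric_ideal n E \<longleftrightarrow> f \<in> carrier ?R \<and> toric_map n f = 0" for f
    unfolding toric_ideal_iff source_ring_def ..
  show ?thesis unfolding source_ring_def
  proof (rule idealI)
    show "ring ?R" by (rule ring_axioms)
    have "\<ominus>\<^bsub>?R\<^esub> f \<in> toric_ideal n E" if "f \<in> toric_ideal n E" for f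
      using that by (simp add: I a_inv_mpoly_ring mpoly_ring_uminus toric_map_minus)
    moreover have "0 \<in> toric_ideal n E" by (simp add: I mpoly_ring_zero_one toric_map_simps)
    moreover have "toric_ideal n E \<subseteq> carrier ?R" using I by blast
    moreover have "f \<oplus>\<^bsub>?R\<^esub> h \<in> toric_ideal n E" if "f \<in> toric_ideal n E" "h \<in> toric_ideal n E" for f h
      using that by (simp add: I mpoly_ring_closed toric_map_simps)
    ultimately show "subgroup (toric_ideal n E) (add_monoid ?R)"
      by (intro add.subgroupI) blast+
  qed (simp_all add: I toric_map_simps mpoly_ring_closed)
qed

section \<open>Generators of the toric ideal\<close>

lemma finite_stable_set: "A \<in> stable_sets {1..n::nat} E \<Longrightarrow> finite A"
  by (rule finite_subset[of A "{1..n}"]) (simp_all add: stable_sets_def)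

lemma set_mset_weight_stable:
  assumes "set_mset M \<subseteq> stable_sets {1..n::nat} E"
  shows "set_mset (weight M) \<subseteq> {1..n}"
proof -
  have "set_mset (weight M) = \<Union>(set_mset M)"
    by (rule set_mset_weight) (use assms finite_stable_set in blast)
  then show ?thesis using assms unfolding stable_sets_def by blast
qed

lemma monomial_in_source_ring:
  "set_mset M \<subseteq> stable_sets {1..n} E \<Longrightarrow> Poly_Mapping.single (mon M) c \<in> carrier (source_ring n E)"
  unfolding source_ring_def by (simp add: in_carrier_mpoly_ring keys_mon)

lemma source_ring_minus:
  assumes "f \<in> carrier (source_ring n E)" "h \<in> carrier (source_ring n E)"
  shows "f - h \<in> carrier (source_ring n E)"
  using assms mpoly_ring_closed(1)[of f _ "- h"] mpoly_ring_uminus[of h] unfolding source_ring_def by simp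

lemma ideal_source_ring_closed:
  assumes "ideal J (source_ring n E)"
  shows "0 \<in> J" "f \<in> J \<Longrightarrow> h \<in> J \<Longrightarrow> f + h \<in> J"
    "f \<in> J \<Longrightarrow> r \<in> carrier (source_ring n E) \<Longrightarrow> r * f \<in> J"
  using additive_subgroup.zero_closed[OF ideal.axioms(1)[OF assms]]
    additive_subgroup.a_closed[OF ideal.axioms(1)[OF assms]] ideal.I_l_closed[OF assms]
  unfolding source_ring_def by simp_all

lemma move_binomial_in_ideal:
  fixes J :: "(nat set, 'k::comm_ring_1) mpoly set"
  assumes J: "ideal J (source_ring n E)"
    and gens: "\<And>f. f \<in> toric_ideal n E \<Longrightarrow> quadratic_binomial f \<Longrightarrow> f \<in> J"
    and mv: "move (stable_sets {1..n} E) M N" and M: "set_mset M \<subseteq> stable_sets {1..n} E"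
  shows "Poly_Mapping.single (mon M) 1 - Poly_Mapping.single (mon N) 1 \<in> J"
proof -
  let ?S = "stable_sets {1..n} E"
  let ?x = "\<lambda>M. Poly_Mapping.single (mon M) 1 :: (nat set, 'k) mpoly"
  obtain A B A' B' P where m: "{A, B, A', B'} \<subseteq> ?S"
    "mset_set A + mset_set B = mset_set A' + mset_set B'" "M = {#A, B#} + P" "N = {#A', B'#} + P"
    using mv unfolding move_def by blast
  let ?q = "?x {#A, B#} - ?x {#A', B'#}"
  have fin: "finite C" if "C \<in># {#A, B#} \<or> C \<in># {#A', B'#}" for C
    using m(1) that by (intro finite_stable_set[of C n E]) auto
  have "?q \<in> J"
  proof (cases "mon {#A, B#} = mon {#A', B'#}")
    case True
    then show ?thesis using ideal_source_ring_closed(1)[OF J] by simp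
  next
    case False
    have "fibre_exponent n {#A, B#} = fibre_exponent n {#A', B'#}"
      using m(2) unfolding fibre_exponent_def by simp
    then have "toric_map n (?x {#A, B#}) = toric_map n (?x {#A', B'#})"
      using fin by (subst (1 2) toric_map_single) auto
    then have "toric_map n ?q = 0"
      using toric_map_simps(1)[of n "?x {#A, B#}" "- ?x {#A', B'#}"] toric_map_minus[of n "?x {#A', B'#}"] by simp
    moreover have "?q \<in> carrier (source_ring n E)"
      using m(1) by (intro source_ring_minus monomial_in_source_ring) auto
    ultimately have "?q \<in> toric_ideal n E" unfolding toric_ideal_iff by simp
    moreover have "quadratic_binomial ?q"
      unfolding quadratic_binomial_def using False mon_degree_mon[of "{#A, B#}"] mon_degree_mon[of "{#A', B'#}"]
      by (intro exI[of _ "mon {#A, B#}"] exI[of _ "mon {#A', B'#}"]) simp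
    ultimately show ?thesis by (rule gens)
  qed
  moreover have "?x P \<in> carrier (source_ring n E)" using M m(3) by (intro monomial_in_source_ring) auto
  ultimately have "?x P * ?q \<in> J" using ideal_source_ring_closed(3)[OF J] by blast
  moreover have "?x P * ?q = ?x M - ?x N"
    unfolding m(3,4) by (simp add: right_diff_distrib mult_single algebra_simps)
  ultimately show ?thesis by simp
qed

lemma moves_binomial_in_ideal:
  fixes J :: "(nat set, 'k::comm_ring_1) mpoly set"
  assumes J: "ideal J (source_ring n E)"
    and gens: "\<And>f. f \<in> toric_ideal n E \<Longrightarrow> quadratic_binomial f \<Longrightarrow> f \<in> J"
    and mv: "(move (stable_sets {1..n} E))\<^sup>*\<^sup>* M N" and M: "set_mset M \<subseteq> stable_sets {1..n} E"
  shows "Poly_Mapping.single (mon M) 1 - Poly_Mapping.single (mon N) 1 \<in> J"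
  using mv
proof (induction rule: rtranclp_induct)
  case base
  then show ?case using ideal_source_ring_closed(1)[OF J] by simp
next
  case (step N N')
  have "set_mset N \<subseteq> stable_sets {1..n} E" using moves_invariants[OF step.hyps(1) M] by blast
  then have "Poly_Mapping.single (mon N) 1 - Poly_Mapping.single (mon N') 1 \<in> J"
    using move_binomial_in_ideal[OF J _ step.hyps(2)] gens by blast
  then show ?case using ideal_source_ring_closed(2)[OF J step.IH] by fastforce
qed

text \<open>In an element of the kernel the coefficients over each fibre sum to zero. Replacing every monomial
  by a fixed representative of its fibre turns the element into zero and changes it only by
  differences of monomials in a common fibre.\<close>

lemma toric_ideal_subset:
  fixes J :: "(nat set, 'k::comm_ring_1) mpoly set"
  assumes sg: "simple_graph {1..n} E" and my: "meyniel E"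
    and J: "ideal J (source_ring n E)"
    and gens: "\<And>f. f \<in> toric_ideal n E \<Longrightarrow> quadratic_binomial f \<Longrightarrow> f \<in> J"
  shows "toric_ideal n E \<subseteq> J"
proof
  fix f :: "(nat set, 'k) mpoly" assume f: "f \<in> toric_ideal n E"
  let ?S = "stable_sets {1..n} E"
  let ?K = "Poly_Mapping.keys f" and ?c = "Poly_Mapping.lookup f"
  have fin: "finite ?K" by simp
  define ms where "ms = (\<lambda>m :: nat set \<Rightarrow>\<^sub>0 nat. SOME M. m = mon M)"
  have ms: "mon (ms m) = m" for m
    unfolding ms_def using someI_ex[of "\<lambda>M. m = mon M"] exponent_eq_mon[of m] by metis
  define \<phi> where "\<phi> = (\<lambda>m. fibre_exponent n (ms m))"
  have sub: "set_mset (ms m) \<subseteq> ?S" if "m \<in> ?K" for m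
    using f that keys_mon[of "ms m"] unfolding toric_ideal_iff source_ring_def in_carrier_mpoly_ring ms by metis
  have finA: "finite A" if "m \<in> ?K" "A \<in># ms m" for m A
    using sub[OF that(1)] that(2) by (intro finite_stable_set) auto
  have "toric_map n f = (\<Sum>m\<in>?K. Poly_Mapping.single (\<phi> m) (?c m))"
  proof -
    have "toric_map n f = (\<Sum>m\<in>?K. toric_map n (Poly_Mapping.single m (?c m)))"
      by (subst mpoly_eq_sum_singles[of f]) (simp add: toric_map_def subst_hom_sum)
    also have "\<dots> = (\<Sum>m\<in>?K. Poly_Mapping.single (\<phi> m) (?c m))"
      using toric_map_single[of "ms _" n] finA unfolding ms \<phi>_def by (intro sum.cong) auto
    finally show ?thesis .
  qed
  then have zero: "(\<Sum>m\<in>?K. Poly_Mapping.single (\<phi> m) (?c m)) = 0"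
    using f unfolding toric_ideal_iff by simp
  have fibre_sum: "(\<Sum>m\<in>{m\<in>?K. \<phi> m = w}. ?c m) = 0" for w
  proof -
    have "(\<Sum>m\<in>{m\<in>?K. \<phi> m = w}. ?c m) = (\<Sum>m\<in>?K. ?c m when \<phi> m = w)"
      by (simp add: when_def sum.inter_filter)
    also have "\<dots> = Poly_Mapping.lookup (\<Sum>m\<in>?K. Poly_Mapping.single (\<phi> m) (?c m)) w"
      by (simp add: lookup_sum lookup_single)
    finally show ?thesis using zero by simp
  qed
  \<comment> \<open>\<open>rep w\<close> is meaningful only if the fibre over \<open>w\<close> contains a monomial of \<open>f\<close>.\<close>
  define rep where "rep = (\<lambda>w. SOME m. m \<in> ?K \<and> \<phi> m = w)"
  have rep: "rep (\<phi> m) \<in> ?K" "\<phi> (rep (\<phi> m)) = \<phi> m" if "m \<in> ?K" for m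
    using someI[of "\<lambda>m'. m' \<in> ?K \<and> \<phi> m' = \<phi> m" m] that unfolding rep_def by auto
  let ?x = "\<lambda>m. Poly_Mapping.single m 1 :: (nat set, 'k) mpoly"
  have "(\<Sum>m\<in>?K. Poly_Mapping.single (rep (\<phi> m)) (?c m)) =
      (\<Sum>w\<in>\<phi> ` ?K. \<Sum>m\<in>{m\<in>?K. \<phi> m = w}. Poly_Mapping.single (rep (\<phi> m)) (?c m))"
    by (rule sum.image_gen[OF fin])
  also have "\<dots> = (\<Sum>w\<in>\<phi> ` ?K. Poly_Mapping.single (rep w) (\<Sum>m\<in>{m\<in>?K. \<phi> m = w}. ?c m))"
    by (intro sum.cong refl) (auto intro!: poly_mapping_eqI simp: lookup_sum lookup_single when_def)
  also have "\<dots> = 0" by (simp only: fibre_sum single_zero sum.neutral_const)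
  finally have reps: "(\<Sum>m\<in>?K. Poly_Mapping.single (rep (\<phi> m)) (?c m)) = 0" .
  have bin: "?x m - ?x (rep (\<phi> m)) \<in> J" if m: "m \<in> ?K" for m
  proof -
    let ?M = "ms m" and ?N = "ms (rep (\<phi> m))"
    have S: "set_mset ?M \<subseteq> ?S" "set_mset ?N \<subseteq> ?S" using sub m rep by auto
    have "fibre_exponent n ?M = fibre_exponent n ?N" using rep(2)[OF m] unfolding \<phi>_def by simp
    then have "size ?M = size ?N" "weight ?M = weight ?N"
      using fibre_exponent_inj S set_mset_weight_stable by blast+
    then have "(move ?S)\<^sup>*\<^sup>* ?M ?N" using fibre_connected[OF sg my S] by blast
    then have "?x (mon ?M) - ?x (mon ?N) \<in> J"
      using moves_binomial_in_ideal[OF J _ _ S(1)] gens by blast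
    then show ?thesis unfolding ms .
  qed
  have "Const c \<in> carrier (source_ring n E)" for c :: 'k
    unfolding Const_def source_ring_def by (simp add: in_carrier_mpoly_ring)
  then have summand: "Const (?c m) * (?x m - ?x (rep (\<phi> m))) \<in> J" if "m \<in> ?K" for m
    using ideal_source_ring_closed(3)[OF J bin[OF that]] by blast
  have J_sum: "(\<Sum>m\<in>F. Const (?c m) * (?x m - ?x (rep (\<phi> m)))) \<in> J" if "finite F" "F \<subseteq> ?K" for F
    using that by (induction F rule: finite_induct) (use ideal_source_ring_closed[OF J] summand in auto)
  have "f = (\<Sum>m\<in>?K. Poly_Mapping.single m (?c m)) - (\<Sum>m\<in>?K. Poly_Mapping.single (rep (\<phi> m)) (?c m))"
    unfolding reps using mpoly_eq_sum_singles[of f] by simp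
  also have "\<dots> = (\<Sum>m\<in>?K. Const (?c m) * (?x m - ?x (rep (\<phi> m))))"
    unfolding sum_subtractf[symmetric]
    by (intro sum.cong refl) (simp add: right_diff_distrib flip: single_eq_Const_mult)
  finally show "f \<in> J" using J_sum[OF fin order_refl] by simp
qed

theorem theorem2p2:
  fixes n :: nat and E :: "nat set set"
  assumes "simple_graph {1..n} E"
    and "meyniel E"
  shows "generated_by_quadratic_binomials (source_ring n E)
           (toric_ideal n E :: (nat set, 'k::field) mpoly set)"
proof -
  let ?R = "source_ring n E :: (nat set, 'k) mpoly ring"
  let ?I = "toric_ideal n E :: (nat set, 'k) mpoly set"
  let ?B = "{f \<in> ?I. quadratic_binomial f}"
  interpret cring ?R unfolding source_ring_def by (rule cring_mpoly_ring)
  have sub: "?B \<subseteq> carrier ?R" using toric_ideal_iff by blast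
  have "ideal (Idl\<^bsub>?R\<^esub> ?B) ?R" by (rule genideal_ideal[OF sub])
  moreover have "f \<in> Idl\<^bsub>?R\<^esub> ?B" if "f \<in> ?I" "quadratic_binomial f" for f
    using genideal_self[OF sub] that by blast
  ultimately have "?I \<subseteq> Idl\<^bsub>?R\<^esub> ?B" using toric_ideal_subset[OF assms] by blast
  moreover have "Idl\<^bsub>?R\<^esub> ?B \<subseteq> ?I" by (rule genideal_minimal[OF ideal_toric_ideal]) blast
  ultimately have "?I = Idl\<^bsub>?R\<^esub> ?B" by blast
  then show ?thesis unfolding generated_by_quadratic_binomials_def using sub by blast
qed

end
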